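(* Let $L \subseteq \mathbb{N}$ be an infinite set with lower density zero. For all $t, s \in \mathbb{N}$ there exists a planar graph $G$ such that (1) for every collection of $t$ $L$-cycles in $G$, there is a vertex lying in all of them, and (2) for every $S \subseteq V(G)$ with $|S| \leq s$, the graph $G - S$ contains an $L$-cycle.
   Context: $\mathbb{N}$ denotes the set of positive integers. Graphs are finite. For $L \subseteq \mathbb{N}$, an $L$-cycle is a cycle whose length (number of edges) lies in $L$. The lower density of $L$ is $\underline{d}(L) := \liminf_{n\to\infty} \frac{|L \cap \{1,\dots,n\}|}{n}$. *)

theory Defs
  imports "HOL-Analysis.Analysis"
begin

record 'a ugraph =
  verts :: "'a set"
  edges :: "'a set set"

definition finite_graph :: "'a ugraph \<Rightarrow> bool" where
  "finite_graph G \<longleftrightarrow> finite (verts G) \<and> (\<forall>e \<in> edges G. e \<subseteq> verts G \<and> card e = 2)"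

definition subgraph :: "'a ugraph \<Rightarrow> 'a ugraph \<Rightarrow> bool" where
  "subgraph H G \<longleftrightarrow> verts H \<subseteq> verts G \<and> edges H \<subseteq> edges G"

definition delete_verts :: "'a ugraph \<Rightarrow> 'a set \<Rightarrow> 'a ugraph" where
  "delete_verts G S = \<lparr>verts = verts G - S, edges = {e \<in> edges G. e \<inter> S = {}}\<rparr>"

definition is_cycle :: "'a ugraph \<Rightarrow> bool" where
  "is_cycle C \<longleftrightarrow> (\<exists>xs. distinct xs \<and> length xs \<ge> 3 \<and> verts C = set xs \<and>
     edges C = {{xs ! i, xs ! (Suc i mod length xs)} | i. i < length xs})"

text \<open>Cycles are subgraphs, so a cycle has neither a base point nor an orientation.\<close>
definition L_cycle :: "nat set \<Rightarrow> 'a ugraph \<Rightarrow> 'a ugraph \<Rightarrow> bool" where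
  "L_cycle L G C \<longleftrightarrow> subgraph C G \<and> is_cycle C \<and> card (edges C) \<in> L"

text \<open>
  A drawing in the plane, which is represented by \<^typ>\<open>complex\<close>: vertices are distinct points,
  and every edge is an arc between its two ends that meets the vertices and the other edges
  only in common ends.
\<close>
definition plane_drawing ::
    "'a ugraph \<Rightarrow> ('a \<Rightarrow> complex) \<Rightarrow> ('a set \<Rightarrow> real \<Rightarrow> complex) \<Rightarrow> bool" where
  "plane_drawing G p \<gamma> \<longleftrightarrow>
     inj_on p (verts G) \<and>
     (\<forall>e \<in> edges G. arc (\<gamma> e) \<and> {pathstart (\<gamma> e), pathfinish (\<gamma> e)} = p ` e) \<and>
     (\<forall>e \<in> edges G. \<forall>v \<in> verts G. p v \<in> path_image (\<gamma> e) \<longrightarrow> v \<in> e) \<and>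
     (\<forall>e \<in> edges G. \<forall>f \<in> edges G. e \<noteq> f \<longrightarrow>
        path_image (\<gamma> e) \<inter> path_image (\<gamma> f) \<subseteq> p ` (e \<inter> f))"

definition planar :: "'a ugraph \<Rightarrow> bool" where
  "planar G \<longleftrightarrow> (\<exists>p \<gamma>. plane_drawing G p \<gamma>)"

definition lower_density :: "nat set \<Rightarrow> ereal" where
  "lower_density L = liminf (\<lambda>n. ereal (real (card (L \<inter> {1..n})) / real n))"

end

theory Submission
  imports Defs "HOL-Number_Theory.Cong"
begin

text \<open>
  The graph is a subdivided annular grid with \<open>s + 1\<close> concentric rings and, on its outside, \<open>k\<close> long
  ears, where \<open>k = r + s\<close> and \<open>t * s < k\<close>. Any \<open>t\<close> cycles using at least \<open>r\<close> ears each have an ear in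
  common. On the other hand \<open>s\<close> vertices miss one of the rings and the surroundings of \<open>r\<close> of the ears;
  the cycle that follows this ring and climbs to these ears survives. The rings are weighted so that
  all these cycles have the same length \<open>r * a + m0 * g\<close>, where \<open>a\<close> is the length of an ear and \<open>g\<close> the
  unit of the grid. A cycle with \<open>j\<close> ears has a length \<open>j * a + m * g\<close> with \<open>m\<close> bounded, so it
  remains to choose \<open>a\<close> and \<open>g\<close> with \<open>r * a + m0 * g \<in> L\<close> but \<open>j * a + m * g \<notin> L\<close> for \<open>j < r\<close>. If \<open>L\<close>
  has long multiplicative gaps, put \<open>g\<close> at the lower end of a gap and \<open>r * a + m0 * g\<close> at the next
  element of \<open>L\<close>. Otherwise some \<open>l \<in> L\<close> has \<open>L\<close> very sparse up to a multiple of \<open>l\<close>, and most solutions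
  of \<open>r * a + m0 * g = l\<close> work.
\<close>

section \<open>Lengths avoiding a sparse set\<close>

text \<open>Otherwise the ratio would be at least \<open>1 / Suc K\<close> from some point on, and
  so would its liminf. \<open>Suc K\<close> in place of \<open>K\<close> keeps this bound meaningful
  for \<open>K = 0\<close>.\<close>

lemma lower_density_zero_sparse:
  assumes "lower_density L = 0"
  shows "\<exists>n\<ge>N. K * card (L \<inter> {1..n}) < n"
proof (rule ccontr)
  assume "\<not> ?thesis"
  then have dense: "n \<le> K * card (L \<inter> {1..n})" if "n \<ge> N" for n
    using that by (meson not_le)
  define \<epsilon> where "\<epsilon> = 1 / real (Suc K)"
  have "\<epsilon> \<le> real (card (L \<inter> {1..n})) / real n" if n: "n \<ge> Suc N" for n
  proof -
    have "real n \<le> real K * real (card (L \<inter> {1..n}))"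
      using dense[of n] n by (metis Suc_leD of_nat_le_iff of_nat_mult)
    also have "\<dots> \<le> real (Suc K) * real (card (L \<inter> {1..n}))"
      by (intro mult_right_mono) auto
    finally show ?thesis
      using n by (simp add: \<epsilon>_def field_simps)
  qed
  then have "eventually (\<lambda>n. ereal \<epsilon> \<le> ereal (real (card (L \<inter> {1..n})) / real n)) sequentially"
    unfolding eventually_sequentially by (intro exI[of _ "Suc N"]) auto
  then have "ereal \<epsilon> \<le> lower_density L"
    unfolding lower_density_def by (rule Liminf_bounded)
  with assms show False by (simp add: \<epsilon>_def)
qed

text \<open>Since \<open>m\<close> is invertible modulo \<open>r\<close>, the congruence prescribes
  a residue class for \<open>g\<close>, and \<open>r\<close> consecutive integers meet every
  class.\<close>

lemma coprime_residue_representative: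
  fixes r m a l :: nat
  assumes "coprime r m" "r \<ge> 1"
  shows "\<exists>g. a \<le> g \<and> g < a + r \<and> [m * g = l] (mod r)"
proof -
  obtain x where x: "[m * x = 1] (mod r)"
    using assms(1) cong_solve_coprime_nat[of m r] by (auto simp: coprime_commute)
  \<comment> \<open>\<open>(r - 1) * a\<close> stands for \<open>-a\<close> modulo \<open>r\<close>,
    so \<open>g\<close> is congruent to \<open>x * l\<close>.\<close>
  define g where "g = a + (x * l + (r - 1) * a) mod r"
  have "[g = a + (x * l + (r - 1) * a)] (mod r)"
    unfolding g_def cong_def by (simp add: mod_simps)
  also have "a + (x * l + (r - 1) * a) = x * l + r * a"
    using assms(2) by (cases r) (auto simp: algebra_simps)
  also have "[x * l + r * a = x * l] (mod r)" by (simp add: cong_def)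
  finally have "[m * g = m * x * l] (mod r)" by (metis cong_scalar_left mult.assoc)
  also have "[m * x * l = 1 * l] (mod r)" using x by (rule cong_scalar_right)
  finally show ?thesis
    using assms(2) by (intro exI[of _ g]) (auto simp: g_def)
qed

lemma cong_difference_quotient:
  fixes a b r :: nat
  assumes "[a = b] (mod r)" "a \<le> b"
  shows "\<exists>q. b = a + r * q"
proof -
  have "r dvd b - a" using assms by (metis cong_altdef_nat' cong_sym_eq dvd_def cong_altdef_nat)
  then show ?thesis using assms(2) by (auto simp: dvd_def) (metis le_add_diff_inverse)
qed

text \<open>Edge lengths just above the lower end of a long gap of \<open>L\<close>: every short combination
  then falls into the gap.\<close>
lemma lengths_from_gap:
  fixes L :: "nat set" and r m0 M A C :: nat
  assumes "infinite L" "coprime r m0" "r \<ge> 1"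
    and A: "A \<ge> r" "A \<ge> 2" and C: "C \<ge> 2 * (r * M + m0 + r)"
    and gap: "L \<inter> {A..C * A} = {}"
  shows "\<exists>e g. e \<ge> 2 \<and> g \<ge> 2 \<and> r * e + m0 * g \<in> L \<and>
    (\<forall>j<r. \<forall>m\<le>M. (j, m) \<noteq> (0, 0) \<longrightarrow> j * e + m * g \<notin> L)"
proof -
  \<comment> \<open>The first element of \<open>L\<close> beyond the gap: the whole range from
    \<open>A\<close> up to \<open>l\<close> then misses \<open>L\<close>.\<close>
  define l where "l = (LEAST x. x \<in> L \<and> x > C * A)"
  obtain x where "x \<in> L \<and> x > C * A"
    using \<open>infinite L\<close> by (meson infinite_nat_iff_unbounded)
  then have l: "l \<in> L" "l > C * A"
    using LeastI[of "\<lambda>x. x \<in> L \<and> x > C * A" x] by (auto simp: l_def)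
  have below: "x \<notin> L" if "A \<le> x" "x < l" for x
    using that gap not_less_Least[of x "\<lambda>x. x \<in> L \<and> x > C * A"]
    by (cases "x \<le> C * A") (auto simp: l_def)
  obtain g where g: "A \<le> g" "g < A + r" "[m0 * g = l] (mod r)"
    using coprime_residue_representative[of r m0 A l] assms by blast
  \<comment> \<open>From \<open>g < 2 * A\<close> and the size of \<open>C\<close>: \<open>l\<close>
    dominates \<open>g\<close> so far that \<open>e\<close> will exceed
    \<open>(M + 1) * g\<close>.\<close>
  have "(r * M + m0 + r) * g \<le> (r * M + m0 + r) * (2 * A)"
    using g A by (intro mult_le_mono2) auto
  also have "\<dots> \<le> C * A" using C mult_le_mono1[OF C, of A] by (simp add: algebra_simps)
  finally have big: "(r * M + m0 + r) * g < l" using l by linarith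
  then have "m0 * g \<le> l" by (simp add: algebra_simps)
  then obtain e where e: "l = m0 * g + r * e"
    using cong_difference_quotient[OF g(3)] by blast
  have "r * ((M + 1) * g) < r * e" using big e by (simp add: algebra_simps)
  then have eg: "(M + 1) * g < e" by simp
  have "j * e + m * g \<notin> L" if jm: "j < r" "m \<le> M" "(j, m) \<noteq> (0, 0)" for j m
  proof (rule below)
    have "A \<le> e" using eg g by simp
    then show "A \<le> j * e + m * g"
      using jm g by (cases j; cases m) auto
    \<comment> \<open>One missing ear loses \<open>e\<close>, which is more than the whole grid part
      \<open>M * g\<close> can restore.\<close>
    have "j * e + m * g \<le> (r - 1) * e + M * g"
      using jm by (intro add_mono mult_le_mono1) auto
    also have "\<dots> < (r - 1) * e + e" using eg by simp
    also have "\<dots> = r * e" using \<open>r \<ge> 1\<close> by (cases r) auto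
    also have "\<dots> \<le> l" using e by simp
    finally show "j * e + m * g < l" .
  qed
  moreover have "g \<ge> 2" "e \<ge> 2" using g A eg by auto
  moreover have "r * e + m0 * g \<in> L" using l e by (simp add: add.commute)
  ultimately show ?thesis by blast
qed

text \<open>Along the solutions of \<open>r * e + m0 * g = l\<close> no short combination is constant, because
  \<open>r\<close> and \<open>m0\<close> are coprime; hence some solution avoids the sparse set altogether.\<close>
lemma lengths_from_sparseness:
  fixes L :: "nat set" and r m0 M l Q :: nat
  assumes "coprime r m0" "r \<ge> 1" "m0 \<ge> 1"
    and l: "l \<in> L" "m0 * (r + 2 + r * Q) + 2 * r \<le> l"
    and sparse: "r * Suc M * card (L \<inter> {1..(M + 1) * l}) < Q"
  shows "\<exists>e g. e \<ge> 2 \<and> g \<ge> 2 \<and> r * e + m0 * g \<in> L \<and>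
    (\<forall>j<r. \<forall>m\<le>M. (j, m) \<noteq> (0, 0) \<longrightarrow> j * e + m * g \<notin> L)"
proof -
  obtain g0 where g0: "2 \<le> g0" "g0 < 2 + r" "[m0 * g0 = l] (mod r)"
    using coprime_residue_representative[of r m0 2 l] assms by blast
  have le: "m0 * g0 + m0 * (r * Q) + 2 * r \<le> l"
  proof -
    have "m0 * g0 \<le> m0 * (r + 2)" using g0 by (intro mult_le_mono2) simp
    then show ?thesis using l(2) by (simp add: algebra_simps)
  qed
  then obtain e0 where e0: "l = m0 * g0 + r * e0"
    using cong_difference_quotient[OF g0(3)] by fastforce
  have "r * (m0 * Q + 2) \<le> r * e0" using le e0 by (simp add: algebra_simps)
  then have e0_big: "m0 * Q + 2 \<le> e0" using \<open>r \<ge> 1\<close> by (metis mult_le_cancel1 not_one_le_zero gr0I)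
  \<comment> \<open>The other solutions: each step trades \<open>m0\<close> units of
    \<open>e\<close> for \<open>r\<close> units of \<open>g\<close>; \<open>q < Q\<close> keeps
    \<open>e q\<close> at least 2.\<close>
  define e where "e q = e0 - m0 * q" for q
  define g where "g q = g0 + r * q" for q
  have eq: "e q + m0 * q = e0" "e q \<ge> 2" if "q < Q" for q
  proof -
    have "m0 * q \<le> m0 * Q" using that by simp
    then show "e q + m0 * q = e0" "e q \<ge> 2" unfolding e_def using e0_big by linarith+
  qed
  have sol: "r * e q + m0 * g q = l" if "q < Q" for q
    using eq(1)[OF that] e0 by (auto simp: g_def algebra_simps)
  define T where "T = {..<r} \<times> {..M} - {(0, 0)}"
  define Bad where "Bad = (\<lambda>(j, m). {q \<in> {..<Q}. j * e q + m * g q \<in> L})"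
  have card_Bad: "card (Bad jm) \<le> card (L \<inter> {1..(M + 1) * l})" if jm: "jm \<in> T" for jm
  proof -
    obtain j m where [simp]: "jm = (j, m)" by force
    have jm': "j < r" "m \<le> M" "(j, m) \<noteq> (0, 0)" using jm by (auto simp: T_def)
    \<comment> \<open>\<open>m * r - j * m0\<close> is the slope of \<open>j * e q + m * g q\<close>
      in \<open>q\<close>. If it vanished, \<open>r\<close> would divide \<open>j\<close>, hence
      \<open>j = 0\<close> as \<open>j < r\<close>, and then \<open>m = 0\<close>.\<close>
    have slope: "j * m0 \<noteq> m * r"
    proof
      assume eq: "j * m0 = m * r"
      then have "r dvd j * m0" by simp
      then have "r dvd j" using \<open>coprime r m0\<close> by (simp add: coprime_dvd_mult_left_iff)
      then have "j = 0" using jm'(1) by (auto dest: dvd_imp_le)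
      then show False using eq jm' \<open>r \<ge> 1\<close> by auto
    qed
    have "inj_on (\<lambda>q. j * e q + m * g q) (Bad jm)"
    proof (rule inj_onI)
      fix q q' assume q: "q \<in> Bad jm" "q' \<in> Bad jm"
        and same: "j * e q + m * g q = j * e q' + m * g q'"
      \<comment> \<open>Over the integers the subtraction in \<open>e\<close> is genuine, and
        equality of two values factors as slope times difference.\<close>
      have "int (e q) = int e0 - int m0 * int q" "int (e q') = int e0 - int m0 * int q'"
        using eq(1)[of q] eq(1)[of q'] q unfolding Bad_def by (auto simp flip: of_nat_mult)
      moreover have "int j * int (e q) + int m * int (g q) = int j * int (e q') + int m * int (g q')"
        using same by (metis of_nat_add of_nat_mult)
      ultimately have "int j * (int e0 - int m0 * int q) + int m * (int g0 + int r * int q) =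
          int j * (int e0 - int m0 * int q') + int m * (int g0 + int r * int q')"
        by (simp only: g_def of_nat_add of_nat_mult)
      then have "(int m * int r - int j * int m0) * (int q - int q') = 0"
        by (simp add: algebra_simps)
      moreover have "int m * int r - int j * int m0 \<noteq> 0"
        using slope by (metis eq_iff_diff_eq_0 of_nat_eq_iff of_nat_mult)
      ultimately show "q = q'" by simp
    qed
    moreover have "(\<lambda>q. j * e q + m * g q) ` Bad jm \<subseteq> L \<inter> {1..(M + 1) * l}"
    proof (rule image_subsetI)
      fix q assume "q \<in> Bad jm"
      then have q: "q < Q" "j * e q + m * g q \<in> L" by (auto simp: Bad_def)
      have "j * e q \<le> r * e q" "m * g q \<le> M * (m0 * g q)"
        using jm' mult_le_mono1[OF \<open>m0 \<ge> 1\<close>, of "g q"] mult_le_mono[of m M "g q" "m0 * g q"] by auto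
      moreover have "M * (m0 * g q) \<le> M * l" "r * e q \<le> l" using sol[OF q(1)] by auto
      ultimately have "j * e q + m * g q \<le> l + M * l" by linarith
      moreover have "j * e q + m * g q \<ge> 1"
        using jm' eq(2)[OF q(1)] g0 by (cases j; cases m) (auto simp: g_def)
      ultimately show "j * e q + m * g q \<in> L \<inter> {1..(M + 1) * l}"
        using q by simp
    qed
    ultimately show ?thesis by (intro card_inj_on_le) auto
  qed
  \<comment> \<open>Union bound: at most \<open>r * Suc M\<close> pairs, each spoiling at most as
    many \<open>q\<close> as \<open>L\<close> has elements up to \<open>(M + 1) * l\<close>;
    together fewer than \<open>Q\<close>.\<close>
  have "card (\<Union> (Bad ` T)) \<le> (\<Sum>jm\<in>T. card (Bad jm))"
    by (intro card_UN_le) (auto simp: T_def)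
  also have "\<dots> \<le> card T * card (L \<inter> {1..(M + 1) * l})"
    using sum_bounded_above[of T "\<lambda>jm. card (Bad jm)"] card_Bad by simp
  also have "card T \<le> r * Suc M"
    using card_mono[of "{..<r} \<times> {..M}" T] by (auto simp: T_def)
  then have "card T * card (L \<inter> {1..(M + 1) * l}) \<le> r * Suc M * card (L \<inter> {1..(M + 1) * l})"
    by (rule mult_le_mono1)
  also note sparse
  finally have "card (\<Union> (Bad ` T)) < card {..<Q}" by simp
  moreover have "finite (\<Union> (Bad ` T))" by (auto simp: T_def Bad_def)
  ultimately have "\<not> {..<Q} \<subseteq> \<Union> (Bad ` T)"
    by (meson card_mono not_less)
  then obtain q where q: "q < Q" "q \<notin> \<Union> (Bad ` T)" by auto
  then have "\<forall>j<r. \<forall>m\<le>M. (j, m) \<noteq> (0, 0) \<longrightarrow> j * e q + m * g q \<notin> L"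
    unfolding T_def Bad_def by fastforce
  moreover have "e q \<ge> 2" "g q \<ge> 2" "r * e q + m0 * g q \<in> L"
    using eq(2)[OF q(1)] g0 sol[OF q(1)] l by (auto simp: g_def)
  ultimately show ?thesis by blast
qed

text \<open>If beyond \<open>A0\<close> no interval \<open>{A..C * A}\<close> misses
  \<open>L\<close>, then \<open>L\<close> has an element \<open>l\<close> within a constant factor
  of any large scale, so sparseness of \<open>L\<close> up to a suitable \<open>n\<close> becomes
  sparseness relative to \<open>l\<close>. Otherwise the gap itself suffices.\<close>

lemma avoiding_lengths_exist:
  fixes L :: "nat set" and r m0 M :: nat
  assumes "infinite L" "lower_density L = 0" "coprime r m0" "r \<ge> 1" "m0 \<ge> 1"
  shows "\<exists>e g. e \<ge> 2 \<and> g \<ge> 2 \<and> r * e + m0 * g \<in> L \<and>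
    (\<forall>j<r. \<forall>m\<le>M. (j, m) \<noteq> (0, 0) \<longrightarrow> j * e + m * g \<notin> L)"
proof -
  define C where "C = 2 * (r * M + m0 + r)"
  \<comment> \<open>The factor 2 confines the term with \<open>Q\<close> in the size condition on
    \<open>l\<close> to half of \<open>l\<close>; \<open>A0\<close> is large enough for the
    remaining terms to fit into the other half.\<close>
  define D where "D = 2 * m0 * r"
  define A0 where "A0 = 2 * (m0 * (r + 2) + 2 * r) + 2 * D + r + 2"
  have pos: "C \<ge> 1" "D \<ge> 1" using assms by (auto simp: C_def D_def)
  show ?thesis
  proof (cases "\<exists>A\<ge>A0. L \<inter> {A..C * A} = {}")
    case True
    then obtain A where "A \<ge> A0" "L \<inter> {A..C * A} = {}" by blast
    then show ?thesis
      using lengths_from_gap[of L r m0 A M C] assms by (auto simp: A0_def C_def)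
  next
    case False
    \<comment> \<open>\<open>n\<close> will be below \<open>4 * (M + 1) * C * D * Q\<close>;
      cancelling \<open>4 * (M + 1) * C * D\<close> leaves the inequality required of
      \<open>Q\<close>.\<close>
    define K where "K = r * Suc M * (4 * (M + 1) * C * D)"
    obtain n where n: "n \<ge> (M + 1) * C * A0" "K * card (L \<inter> {1..n}) < n"
      using lower_density_zero_sparse[OF assms(2)] by blast
    \<comment> \<open>Scaled so that every \<open>l \<le> C * A\<close> satisfies
      \<open>(M + 1) * l \<le> n\<close>, while \<open>l \<ge> A\<close> makes \<open>n\<close> at
      most a constant multiple of \<open>l\<close>.\<close>
    define A where "A = n div ((M + 1) * C)"
    have A: "A \<ge> A0"
      using n(1) pos unfolding A_def
      by (metis div_le_mono nonzero_mult_div_cancel_left mult_eq_0_iff Suc_eq_plus1 nat.distinct(1) not_one_le_zero)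
    then obtain l where l: "l \<in> L" "A \<le> l" "l \<le> C * A" using False by fastforce
    have "(M + 1) * l \<le> (M + 1) * (C * A)" using l by (intro mult_le_mono2)
    also have "\<dots> \<le> n" unfolding A_def by (metis mult.assoc times_div_less_eq_dividend)
    finally have len: "(M + 1) * l \<le> n" .
    have "n < (M + 1) * C * (A + 1)"
      using pos dividend_less_times_div[of "(M + 1) * C" n] by (simp add: A_def)
    also have "\<dots> \<le> (M + 1) * C * (2 * l)"
      using l A by (intro mult_le_mono2) (auto simp: A0_def)
    finally have n_le: "n < (M + 1) * C * (2 * l)" .
    define Q where "Q = l div D"
    have DQ: "D * Q \<le> l" by (simp add: Q_def)
    have lQ: "l < D * (Q + 1)" using pos dividend_less_times_div[of D l] by (simp add: Q_def)
    have lA: "l \<ge> A0" using l A by simp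
    have "Q \<ge> 1"
    proof (rule ccontr)
      assume "\<not> Q \<ge> 1"
      then have "Q = 0" by simp
      then show False using lQ lA by (simp add: A0_def)
    qed
    have "D * (Q + 1) \<le> 2 * (D * Q)" using \<open>Q \<ge> 1\<close> by (simp add: algebra_simps)
    then have l2: "l < 2 * (D * Q)" using lQ by linarith
    show ?thesis
    proof (rule lengths_from_sparseness[OF assms(3-5) l(1)])
      have "2 * (m0 * (r * Q)) \<le> l" using DQ by (simp add: D_def mult_ac)
      moreover have "2 * (m0 * (r + 2) + 2 * r) + 2 * (m0 * (r * Q)) \<le> 2 * l"
      proof -
        have "A0 \<ge> 2 * (m0 * (r + 2) + 2 * r)" by (simp add: A0_def)
        then show ?thesis using lA \<open>2 * (m0 * (r * Q)) \<le> l\<close> by linarith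
      qed
      ultimately show "m0 * (r + 2 + r * Q) + 2 * r \<le> l" by (simp add: algebra_simps)
      let ?c = "card (L \<inter> {1..(M + 1) * l})"
      have "?c \<le> card (L \<inter> {1..n})" using len by (intro card_mono) auto
      then have "K * ?c < n" using n(2) by (meson le_less_trans mult_le_mono2)
      also note n_le
      also have "(M + 1) * C * (2 * l) \<le> (M + 1) * C * (2 * (2 * (D * Q)))"
        using l2 by (intro mult_le_mono2) auto
      finally have "(4 * (M + 1) * C * D) * (r * Suc M * ?c) < (4 * (M + 1) * C * D) * Q"
        by (simp add: K_def algebra_simps)
      then show "r * Suc M * ?c < Q" by (metis mult_less_cancel1)
    qed
  qed
qed

section \<open>Cycles as lists\<close>

fun path_edges :: "'a list \<Rightarrow> 'a set set" where
  "path_edges (x # y # zs) = insert {x, y} (path_edges (y # zs))"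
| "path_edges _ = {}"

lemma path_edges_append:
  "path_edges (xs @ y # ys) = path_edges (xs @ [y]) \<union> path_edges (y # ys)"
proof (induction xs)
  case (Cons x xs)
  then show ?case by (cases xs) auto
qed simp

lemma path_edges_nth: "path_edges xs = {{xs ! i, xs ! Suc i} | i. Suc i < length xs}"
proof (induction xs rule: path_edges.induct)
  case (1 x y zs)
  have "{{(x # y # zs) ! i, (x # y # zs) ! Suc i} | i. Suc i < length (x # y # zs)} =
    (\<lambda>i. {(x # y # zs) ! i, (x # y # zs) ! Suc i}) ` {..<Suc (length zs)}" by auto
  also have "\<dots> = insert {x, y} ((\<lambda>i. {(y # zs) ! i, (y # zs) ! Suc i}) ` {..<length zs})"
    unfolding lessThan_Suc_eq_insert_0 by (simp add: image_image)
  also have "(\<lambda>i. {(y # zs) ! i, (y # zs) ! Suc i}) ` {..<length zs} = path_edges (y # zs)"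
    unfolding 1 by auto
  finally show ?case by simp
qed auto

lemma path_edges_rev: "path_edges (rev xs) = path_edges xs"
proof (induction xs rule: path_edges.induct)
  case (1 x y zs)
  then show ?case by (simp add: path_edges_append[of "rev zs" y "[x]"] insert_commute)
qed auto

lemma path_edges_map_upt:
  "path_edges (map f [m..<Suc n]) = (\<lambda>i. {f i, f (Suc i)}) ` {m..<n}"
proof (induction n)
  case (Suc n)
  show ?case
  proof (cases "m \<le> n")
    case True
    then have "map f [m..<Suc (Suc n)] = map f [m..<n] @ f n # [f (Suc n)]"
      and "map f [m..<n] @ [f n] = map f [m..<Suc n]"
      by auto
    then have "path_edges (map f [m..<Suc (Suc n)]) = path_edges (map f [m..<Suc n]) \<union> {{f n, f (Suc n)}}"
      using path_edges_append[of "map f [m..<n]" "f n" "[f (Suc n)]"] by simp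
    then show ?thesis
      using True unfolding Suc by (simp add: atLeastLessThanSuc insert_commute)
  next
    case False
    then show ?thesis by (cases "m = Suc n") auto
  qed
qed (cases m; simp)

text \<open>Each block is completed by the head of the next one. The value \<open>h n\<close> is
  free; putting the head of the first block there closes a cycle.\<close>

lemma path_edges_concat:
  assumes "\<And>i. i < n \<Longrightarrow> B i \<noteq> []" "\<And>i. i < n \<Longrightarrow> hd (B i) = h i"
  shows "path_edges (concat (map B [0..<n]) @ [h n]) = (\<Union>i<n. path_edges (B i @ [h (Suc i)]))"
  using assms
proof (induction n)
  case (Suc n)
  obtain b bs where b: "B n = b # bs" using Suc.prems(1)[of n] by (cases "B n") auto
  then have "h n = b" using Suc.prems(2)[of n] by auto
  then show ?case
    using Suc b path_edges_append[of "concat (map B [0..<n])" b "bs @ [h (Suc n)]"]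
    by (auto simp: lessThan_Suc)
qed simp

lemma distinct_concat_blocks:
  assumes "\<And>i. i < n \<Longrightarrow> distinct (B i)"
    and "\<And>i j. i < j \<Longrightarrow> j < n \<Longrightarrow> set (B i) \<inter> set (B j) = {}"
  shows "distinct (concat (map B [0..<n]))"
  using assms
proof (induction n)
  case (Suc n)
  have "set (concat (map B [0..<n])) \<inter> set (B n) = {}"
    using Suc.prems(2)[of _ n] by (auto; blast)
  moreover have "distinct (concat (map B [0..<n]))"
    by (rule Suc.IH) (use Suc.prems in auto)
  ultimately show ?case using Suc.prems(1)[of n] by auto
qed simp

lemma length_concat_blocks:
  assumes "\<And>i. i < n \<Longrightarrow> c \<le> length (B i)"
  shows "n * c \<le> length (concat (map B [0..<n]))"
  using assms
proof (induction n)
  case (Suc n)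
  then show ?case using Suc.prems[of n] by fastforce
qed simp

text \<open>Repeating the head at the end replaces the modular indices of \<open>is_cycle\<close> by
  \<open>path_edges\<close>, which splits along concatenations.\<close>

definition cycle_edges :: "'a list \<Rightarrow> 'a set set" where
  "cycle_edges xs = path_edges (xs @ [hd xs])"

lemma cycle_edges_nth:
  "cycle_edges xs = {{xs ! i, xs ! (Suc i mod length xs)} | i. i < length xs}"
proof (cases "xs = []")
  case False
  have "{(xs @ [hd xs]) ! i, (xs @ [hd xs]) ! Suc i} = {xs ! i, xs ! (Suc i mod length xs)}"
    if "i < length xs" for i
    using that False by (cases "Suc i = length xs") (auto simp: nth_append hd_conv_nth)
  then show ?thesis
    unfolding cycle_edges_def path_edges_nth setcompr_eq_image by (intro image_cong) auto
qed (simp add: cycle_edges_def)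

lemma is_cycle_alt:
  "is_cycle C \<longleftrightarrow> (\<exists>xs. distinct xs \<and> length xs \<ge> 3 \<and> verts C = set xs \<and> edges C = cycle_edges xs)"
  by (simp add: is_cycle_def cycle_edges_nth)

lemma cycle_edges_concat:
  assumes "n > 0" "\<And>i. i < n \<Longrightarrow> B i \<noteq> []"
  shows "cycle_edges (concat (map B [0..<n])) =
    (\<Union>i<n. path_edges (B i @ [hd (B (Suc i mod n))]))"
proof -
  have "hd (concat (map B [0..<n])) = hd (B 0)"
    using assms by (simp add: upt_conv_Cons)
  then show ?thesis
    using path_edges_concat[of n B "\<lambda>i. hd (B (i mod n))"] assms
    by (simp add: cycle_edges_def)
qed

lemma Union_cycle_edges: "\<Union> (cycle_edges xs) = set xs"
proof
  show "set xs \<subseteq> \<Union> (cycle_edges xs)"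
    unfolding cycle_edges_nth in_set_conv_nth subset_iff by blast
  have "xs ! (Suc i mod length xs) \<in> set xs" if "i < length xs" for i
    using that by (intro nth_mem mod_less_divisor) auto
  then show "\<Union> (cycle_edges xs) \<subseteq> set xs"
    unfolding cycle_edges_nth by auto
qed

lemma cycle_verts: "is_cycle C \<Longrightarrow> verts C = \<Union> (edges C)"
  unfolding is_cycle_alt using Union_cycle_edges by metis

lemma cycle_edges_nonempty: "is_cycle C \<Longrightarrow> edges C \<noteq> {}"
  by (metis Union_cycle_edges Union_empty is_cycle_alt length_0_conv not_numeral_le_zero set_empty)

text \<open>The vertex at position \<open>i\<close> lies on the edges at positions
  \<open>i - 1\<close> and \<open>i\<close>, read cyclically; the given edge is at most one of
  them.\<close>

lemma cycle_second_edge: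
  assumes "is_cycle C" "E \<in> edges C" "x \<in> E"
  shows "\<exists>F\<in>edges C. x \<in> F \<and> F \<noteq> E"
proof -
  obtain xs where xs: "distinct xs" "length xs \<ge> 3" "edges C = cycle_edges xs"
    using assms(1) by (auto simp: is_cycle_alt)
  let ?n = "length xs" and ?e = "\<lambda>i. {xs ! i, xs ! (Suc i mod length xs)}"
  have "x \<in> set xs" using assms(2,3) xs(3) Union_cycle_edges[of xs] by auto
  then obtain i where i: "i < ?n" "x = xs ! i" by (auto simp: in_set_conv_nth)
  define p where "p = (if i = 0 then ?n - 1 else i - 1)"
  have p: "p < ?n" "Suc p mod ?n = i" using xs(2) i by (auto simp: p_def)
  have q: "Suc i mod ?n < ?n" using xs(2) by (intro mod_less_divisor) auto
  \<comment> \<open>Length at least 3 enters here: with two vertices both edges would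
    coincide.\<close>
  have "p \<noteq> Suc i mod ?n" "p \<noteq> i"
    using xs(2) i by (auto simp: p_def mod_Suc split: if_splits)
  then have "?e p \<noteq> ?e i"
    using xs(1) i(1) p q by (auto simp: doubleton_eq_iff nth_eq_iff_index_eq)
  moreover have "?e p \<in> edges C" "?e i \<in> edges C"
    using p i unfolding xs(3) cycle_edges_nth by blast+
  moreover have "x \<in> ?e p" "x \<in> ?e i" using p i by auto
  ultimately show ?thesis by metis
qed

section \<open>Subdivisions\<close>

text \<open>A simple graph is given by a set \<open>E\<close> of arbitrarily oriented edges; each \<open>e \<in> E\<close> becomes a
  path of length \<open>w e\<close> whose inner vertices are \<open>inn e 1, \<dots>, inn e (w e - 1)\<close>.\<close>
locale subdivision =
  fixes E :: "('v \<times> 'v) set" and w :: "'v \<times> 'v \<Rightarrow> nat"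
    and br :: "'v \<Rightarrow> 'a" and inn :: "'v \<times> 'v \<Rightarrow> nat \<Rightarrow> 'a"
  assumes finite_E: "finite E"
    and no_loop: "(u, v) \<in> E \<Longrightarrow> u \<noteq> v"
    and asym: "(u, v) \<in> E \<Longrightarrow> (v, u) \<notin> E"
    and w_ge_2: "e \<in> E \<Longrightarrow> 2 \<le> w e"
    and br_eq_iff: "br u = br v \<longleftrightarrow> u = v"
    and inn_eq_iff: "inn e i = inn f j \<longleftrightarrow> e = f \<and> i = j"
    and br_neq_inn: "br u \<noteq> inn e i"
begin

definition pt :: "'v \<times> 'v \<Rightarrow> nat \<Rightarrow> 'a" where
  "pt e i = (if i = 0 then br (fst e) else if i = w e then br (snd e) else inn e i)"

definition pts :: "'v \<times> 'v \<Rightarrow> 'a set" where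
  "pts e = pt e ` {..w e}"

definition seg :: "'v \<times> 'v \<Rightarrow> nat \<Rightarrow> 'a set" where
  "seg e i = {pt e i, pt e (Suc i)}"

definition segs :: "'v \<times> 'v \<Rightarrow> 'a set set" where
  "segs e = seg e ` {..<w e}"

definition G :: "'a ugraph" where
  "G = \<lparr>verts = \<Union> (pts ` E), edges = \<Union> (segs ` E)\<rparr>"

lemma pt_0 [simp]: "pt e 0 = br (fst e)"
  by (simp add: pt_def)

lemma pt_w [simp]: "e \<in> E \<Longrightarrow> pt e (w e) = br (snd e)"
  using w_ge_2[of e] by (simp add: pt_def)

lemma pt_eq_inner:
  assumes "0 < i" "i < w e" "pt e i = pt f j"
  shows "e = f \<and> i = j"
  using assms br_neq_inn[of _ e i] inn_eq_iff by (auto simp: pt_def split: if_splits dest: sym)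

lemma pt_eq_iff:
  assumes "e \<in> E" "i \<le> w e" "j \<le> w e"
  shows "pt e i = pt e j \<longleftrightarrow> i = j"
proof -
  have "fst e \<noteq> snd e" using no_loop[of "fst e" "snd e"] assms by auto
  then show ?thesis
    using assms w_ge_2[of e] pt_eq_inner[of i e e j] pt_eq_inner[of j e e i]
    by (auto simp: pt_def br_eq_iff)
qed

lemma pts_meet:
  assumes "e \<in> E" "f \<in> E" "e \<noteq> f" "x \<in> pts e" "x \<in> pts f"
  shows "\<exists>u \<in> {fst e, snd e} \<inter> {fst f, snd f}. x = br u"
proof -
  obtain i j where ij: "i \<le> w e" "j \<le> w f" "x = pt e i" "x = pt f j"
    using assms by (auto simp: pts_def)
  have "i = 0 \<or> i = w e" "j = 0 \<or> j = w f"
    using pt_eq_inner[of i e f j] pt_eq_inner[of j f e i] ij assms(3)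
    by (metis gr0I le_neq_implies_less)+
  then show ?thesis using ij assms by (auto simp: br_eq_iff)
qed

lemma Union_segs: "e \<in> E \<Longrightarrow> \<Union> (segs e) = pts e"
proof (intro equalityI subsetI)
  fix x assume e: "e \<in> E" "x \<in> pts e"
  then obtain i where "i \<le> w e" "x = pt e i" by (auto simp: pts_def)
  then have "x \<in> seg e (if i = w e then i - 1 else i)" "(if i = w e then i - 1 else i) < w e"
    using w_ge_2[OF e(1)] by (auto simp: seg_def)
  then show "x \<in> \<Union> (segs e)" by (auto simp: segs_def)
qed (auto simp: segs_def seg_def pts_def)

lemma Union_Union_segs:
  assumes "A \<subseteq> E"
  shows "\<Union> (\<Union> (segs ` A)) = \<Union> (pts ` A)"
proof -
  have "\<Union> (\<Union> (segs ` A)) = (\<Union>e\<in>A. \<Union> (segs e))" by blast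
  also have "\<dots> = \<Union> (pts ` A)" by (intro SUP_cong refl Union_segs subsetD[OF assms])
  finally show ?thesis .
qed

text \<open>As \<open>w e \<ge> 2\<close>, every segment has an inner vertex as an end, and this
  vertex determines the edge \<open>e\<close>.\<close>

lemma seg_eq_iff:
  assumes "e \<in> E" "f \<in> E" "i < w e" "j < w f"
  shows "seg e i = seg f j \<longleftrightarrow> e = f \<and> i = j"
proof
  assume eq: "seg e i = seg f j"
  have "(0 < i \<and> i < w e) \<or> (0 < Suc i \<and> Suc i < w e)"
    using w_ge_2[OF assms(1)] assms(3) by linarith
  then have "e = f"
    using eq pt_eq_inner[of i e f] pt_eq_inner[of "Suc i" e f] by (auto simp: seg_def doubleton_eq_iff)
  then show "e = f \<and> i = j"
    using eq assms by (auto simp: seg_def doubleton_eq_iff pt_eq_iff)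
qed auto

lemma card_Union_segs:
  assumes "A \<subseteq> E"
  shows "card (\<Union> (segs ` A)) = sum w A"
proof -
  have "card (\<Union> (segs ` A)) = (\<Sum>e\<in>A. card (segs e))"
  proof (rule card_UN_disjoint)
    show "finite A" using assms finite_E finite_subset by blast
    show "\<forall>e\<in>A. \<forall>f\<in>A. e \<noteq> f \<longrightarrow> segs e \<inter> segs f = {}"
    proof (intro ballI impI equals0I)
      fix e f x assume *: "e \<in> A" "f \<in> A" "e \<noteq> f" "x \<in> segs e \<inter> segs f"
      then obtain i j where "i < w e" "j < w f" "x = seg e i" "x = seg f j"
        by (auto simp: segs_def)
      with * show False using seg_eq_iff[of e f i j] assms by auto
    qed
  qed (auto simp: segs_def)
  also have "\<dots> = sum w A"
  proof (rule sum.cong)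
    fix e assume "e \<in> A"
    then have "inj_on (seg e) {..<w e}"
      using assms seg_eq_iff[of e e] by (auto simp: inj_on_def)
    then show "card (segs e) = w e" by (simp add: segs_def card_image)
  qed simp
  finally show ?thesis .
qed

lemma finite_graph_G: "finite_graph G"
proof -
  have "card (seg e i) = 2 \<and> seg e i \<subseteq> pts e" if "e \<in> E" "i < w e" for e i
    using that pt_eq_iff[of e i "Suc i"] by (auto simp: seg_def pts_def)
  then show ?thesis
    using finite_E by (fastforce simp: finite_graph_def G_def segs_def pts_def)
qed

text \<open>Inner vertices of a subdivided edge have degree two, so a cycle through one segment must
  run through the entire path.\<close>

lemma cycle_contains_segs:
  assumes "is_cycle C" "subgraph C G" "e \<in> E" "i < w e" "seg e i \<in> edges C"
  shows "segs e \<subseteq> edges C"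
proof -
  \<comment> \<open>\<open>seg e j\<close> and \<open>seg e k\<close> are the two segments at the
    inner vertex \<open>pt e (Suc m)\<close>; the unordered pair lets one statement serve both
    directions.\<close>
  have other: "seg e k \<in> edges C" if k: "seg e j \<in> edges C" "{j, k} = {m, Suc m}" "Suc m < w e" for j k m
  proof -
    have "pt e (Suc m) \<in> seg e j" using k by (auto simp: seg_def doubleton_eq_iff)
    then obtain F where F: "F \<in> edges C" "pt e (Suc m) \<in> F" "F \<noteq> seg e j"
      using cycle_second_edge assms(1) k(1) by metis
    have "F \<in> edges G" using F(1) assms(2) by (auto simp: subgraph_def)
    then obtain f l where f: "f \<in> E" "l < w f" "F = seg f l"
      by (auto simp: G_def segs_def)
    then have "f = e \<and> (l = Suc m \<or> l = m)"
      using F(2) pt_eq_inner[of "Suc m" e f] k(3) by (auto simp: seg_def)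
    then have "F = seg e k" using f F(3) k(2) by (auto simp: doubleton_eq_iff)
    then show ?thesis using F by simp
  qed
  have down: "seg e 0 \<in> edges C" if "m < w e" "seg e m \<in> edges C" for m
    using that by (induction m) (auto intro: other)
  have "seg e m \<in> edges C" if "m < w e" for m
    using that
  proof (induction m)
    case (Suc m)
    then show ?case by (intro other[of m "Suc m" m]) auto
  qed (use down assms in blast)
  then show ?thesis by (auto simp: segs_def)
qed

text \<open>Only a set of edges is extracted, without a cyclic order: it determines the vertices
  and, via \<open>card_Union_segs\<close>, the length.\<close>

lemma cycle_decomposition:
  assumes "is_cycle C" "subgraph C G"
  obtains A where "A \<subseteq> E" "A \<noteq> {}" "edges C = \<Union> (segs ` A)" "verts C = \<Union> (pts ` A)"
proof -
  define A where "A = {e \<in> E. segs e \<subseteq> edges C}"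
  have sub: "A \<subseteq> E" by (auto simp: A_def)
  have edges: "edges C = \<Union> (segs ` A)"
  proof (intro equalityI subsetI)
    fix F assume F: "F \<in> edges C"
    then have "F \<in> edges G" using assms(2) by (auto simp: subgraph_def)
    then obtain e i where e: "e \<in> E" "i < w e" "F = seg e i"
      by (auto simp: G_def segs_def)
    then have "e \<in> A" using cycle_contains_segs[OF assms e(1,2)] F by (auto simp: A_def)
    with e show "F \<in> \<Union> (segs ` A)" by (auto simp: segs_def)
  qed (auto simp: A_def)
  moreover have "verts C = \<Union> (pts ` A)"
    using cycle_verts[OF assms(1)] edges Union_Union_segs[OF sub] by simp
  moreover have "A \<noteq> {}" using edges cycle_edges_nonempty[OF assms(1)] by auto
  ultimately show ?thesis using that sub by blast
qed

text \<open>Each edge of the cycle \<open>vs\<close> is replaced by its path, run forwards or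
  backwards according to the orientation stored in \<open>A\<close>.\<close>

lemma lift_cycle:
  assumes vs: "distinct vs" "length vs \<ge> 3"
    and A: "A \<subseteq> E" "(\<lambda>(u, v). {u, v}) ` A = cycle_edges vs"
  shows "is_cycle \<lparr>verts = \<Union> (pts ` A), edges = \<Union> (segs ` A)\<rparr>"
proof -
  define n where "n = length vs"
  define s where "s i = Suc i mod n" for i
  have n: "n \<ge> 3" using vs by (simp add: n_def)
  have s_less: "s i < n" for i using n by (auto simp: s_def)
  have "\<exists>e\<in>A. {fst e, snd e} = {vs ! i, vs ! s i}" if "i < n" for i
  proof -
    have "{vs ! i, vs ! s i} \<in> cycle_edges vs"
      using that unfolding cycle_edges_nth n_def s_def by blast
    then show ?thesis unfolding A(2)[symmetric] by force
  qed
  then obtain ed where ed: "\<And>i. i < n \<Longrightarrow> ed i \<in> A \<and> {fst (ed i), snd (ed i)} = {vs ! i, vs ! s i}"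
    by metis
  have ed_E: "ed i \<in> E" if "i < n" for i using ed[OF that] A by auto
  have ed_cases: "(fst (ed i) = vs ! i \<and> snd (ed i) = vs ! s i) \<or>
      (fst (ed i) = vs ! s i \<and> snd (ed i) = vs ! i)" if "i < n" for i
    using ed[OF that] by (simp add: doubleton_eq_iff)
  have neq: "vs ! i \<noteq> vs ! s i" if "i < n" for i
  proof -
    have "i \<noteq> s i" using that n by (auto simp: s_def mod_Suc split: if_splits)
    then show ?thesis using that s_less[of i] vs by (simp add: n_def nth_eq_iff_index_eq)
  qed
  \<comment> \<open>By \<open>asym\<close> an unordered edge has a single oriented
    representative.\<close>
  have A_eq: "A = ed ` {..<n}"
  proof (intro equalityI subsetI)
    fix a assume a: "a \<in> A"
    then have "{fst a, snd a} \<in> cycle_edges vs" unfolding A(2)[symmetric] by force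
    then obtain i where i: "i < n" "{fst a, snd a} = {vs ! i, vs ! s i}"
      unfolding cycle_edges_nth n_def s_def by blast
    then have "{fst a, snd a} = {fst (ed i), snd (ed i)}" using ed by simp
    then have "a = ed i \<or> a = (snd (ed i), fst (ed i))"
      by (auto simp: doubleton_eq_iff prod_eq_iff)
    moreover have "(snd (ed i), fst (ed i)) \<notin> E"
      using asym[of "fst (ed i)" "snd (ed i)"] ed_E[OF i(1)] by simp
    ultimately show "a \<in> ed ` {..<n}" using a A(1) i(1) by auto
  qed (use ed in auto)
  \<comment> \<open>A block omits its final branch vertex, which is the head of the following block.
    Backward traversal therefore starts at position \<open>w (ed i)\<close> and stops at 1.\<close>
  define B where "B i = (if fst (ed i) = vs ! i then map (pt (ed i)) [0..<w (ed i)]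
    else rev (map (pt (ed i)) [1..<Suc (w (ed i))]))" for i
  have w2: "w (ed i) \<ge> 2" if "i < n" for i using w_ge_2 ed_E that by blast
  have B_ne: "B i \<noteq> []" if "i < n" for i using w2[OF that] by (auto simp: B_def)
  have hd_B: "hd (B i) = br (vs ! i)" if "i < n" for i
    using w2[OF that] ed_cases[OF that] ed_E[OF that]
    by (auto simp: B_def hd_rev last_map upt_rec[of 0] simp del: upt_Suc)
  have B_path: "path_edges (B i @ [hd (B (Suc i mod n))]) = segs (ed i)" if "i < n" for i
  proof -
    have end_eq: "hd (B (Suc i mod n)) = br (vs ! s i)" using hd_B[of "s i"] s_less by (simp add: s_def)
    have segs_eq: "segs (ed i) = path_edges (map (pt (ed i)) [0..<Suc (w (ed i))])"
      unfolding path_edges_map_upt segs_def seg_def by (simp add: atLeast0LessThan)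
    show ?thesis
    proof (cases "fst (ed i) = vs ! i")
      case True
      then have "B i @ [br (vs ! s i)] = map (pt (ed i)) [0..<Suc (w (ed i))]"
        using ed_cases[OF that] neq[OF that] ed_E[OF that] by (auto simp: B_def)
      then show ?thesis by (simp add: end_eq segs_eq)
    next
      case False
      then have "br (vs ! s i) = pt (ed i) 0" using ed_cases[OF that] by auto
      then have "B i @ [br (vs ! s i)] = rev (map (pt (ed i)) [0..<Suc (w (ed i))])"
        using False by (simp add: B_def upt_conv_Cons del: upt_Suc)
      then show ?thesis by (simp add: end_eq segs_eq path_edges_rev del: upt_Suc)
    qed
  qed
  have set_B: "set (B i) \<subseteq> insert (br (vs ! i)) (range (inn (ed i)))" if "i < n" for i
    using ed_cases[OF that] ed_E[OF that] by (auto simp: B_def pt_def)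
  define xs where "xs = concat (map B [0..<n])"
  have "distinct xs"
    unfolding xs_def
  proof (rule distinct_concat_blocks)
    fix i assume "i < n"
    then have "inj_on (pt (ed i)) {..w (ed i)}"
      by (intro inj_onI) (simp add: pt_eq_iff ed_E)
    then have "inj_on (pt (ed i)) {0..<w (ed i)}" "inj_on (pt (ed i)) {1..<Suc (w (ed i))}"
      by (rule inj_on_subset; auto)+
    then show "distinct (B i)"
      by (simp add: B_def distinct_map del: upt_Suc)
  next
    fix i j assume ij: "i < j" "j < n"
    \<comment> \<open>Two positions sharing an edge would be successors of each other, impossible on
      at least 3 vertices.\<close>
    have "ed i \<noteq> ed j"
    proof
      assume "ed i = ed j"
      then have "{vs ! i, vs ! s i} = {vs ! j, vs ! s j}" using ed ij by (metis less_trans)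
      then have "i = s j \<and> s i = j"
        using ij s_less vs by (auto simp: doubleton_eq_iff n_def nth_eq_iff_index_eq)
      then show False using ij n by (auto simp: s_def mod_Suc split: if_splits)
    qed
    moreover have "vs ! i \<noteq> vs ! j" using ij vs by (simp add: n_def nth_eq_iff_index_eq)
    ultimately have "insert (br (vs ! i)) (range (inn (ed i))) \<inter>
        insert (br (vs ! j)) (range (inn (ed j))) = {}"
      by (auto simp: br_eq_iff inn_eq_iff br_neq_inn br_neq_inn[symmetric])
    moreover have "i < n" using ij by simp
    ultimately show "set (B i) \<inter> set (B j) = {}"
      using set_B[of i] set_B[of j] ij(2) by blast
  qed
  moreover have "length xs \<ge> 3"
    using length_concat_blocks[of n 1 B] B_ne n by (simp add: xs_def Suc_le_eq)
  moreover have xs_edges: "cycle_edges xs = \<Union> (segs ` A)"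
  proof -
    have "cycle_edges xs = (\<Union>i<n. path_edges (B i @ [hd (B (Suc i mod n))]))"
      unfolding xs_def using n by (intro cycle_edges_concat B_ne) auto
    also have "\<dots> = (\<Union>i<n. segs (ed i))" using B_path by (intro SUP_cong) auto
    finally show ?thesis by (simp add: A_eq)
  qed
  moreover have "set xs = \<Union> (pts ` A)"
    using Union_cycle_edges[of xs] Union_Union_segs[OF A(1)] unfolding xs_edges by simp
  ultimately show ?thesis unfolding is_cycle_alt by (intro exI[of _ xs]) simp
qed

text \<open>A drawing of the unsubdivided graph is cut up: the arc of \<open>e\<close> is split at
  the equidistant parameters \<open>i / w e\<close>, whose points represent the vertices
  \<open>pt e i\<close>.\<close>

lemma planar_G:
  fixes p :: "'v \<Rightarrow> complex" and \<gamma> :: "'v \<times> 'v \<Rightarrow> real \<Rightarrow> complex"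
  defines "V \<equiv> fst ` E \<union> snd ` E"
  assumes inj_p: "inj_on p V"
    and arc: "\<And>e. e \<in> E \<Longrightarrow> arc (\<gamma> e)"
    and ends: "\<And>e. e \<in> E \<Longrightarrow> \<gamma> e 0 = p (fst e)" "\<And>e. e \<in> E \<Longrightarrow> \<gamma> e 1 = p (snd e)"
    and off_V: "\<And>e x. e \<in> E \<Longrightarrow> 0 < x \<Longrightarrow> x < 1 \<Longrightarrow> \<gamma> e x \<notin> p ` V"
    and disjoint: "\<And>e f x y. e \<in> E \<Longrightarrow> f \<in> E \<Longrightarrow> 0 < x \<Longrightarrow> x < 1 \<Longrightarrow> 0 < y \<Longrightarrow> y < 1 \<Longrightarrow>
      \<gamma> e x = \<gamma> f y \<Longrightarrow> e = f"
  shows "planar G"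
proof -
  define tm where "tm e i = real i / real (w e)" for e i
  have w_pos: "0 < real (w e)" if "e \<in> E" for e using w_ge_2[OF that] by simp
  have tm_01: "0 \<le> tm e i" "tm e i \<le> 1" if "e \<in> E" "i \<le> w e" for e i
    using that w_pos[of e] by (auto simp: tm_def)
  have tm_w [simp]: "tm e (w e) = 1" if "e \<in> E" for e using w_pos[OF that] by (simp add: tm_def)
  have tm_le: "tm e i \<le> tm e j \<longleftrightarrow> i \<le> j" if "e \<in> E" for e i j
    using w_pos[OF that] by (simp add: tm_def divide_le_cancel)
  have in_V: "fst e \<in> V" "snd e \<in> V" if "e \<in> E" for e using that by (auto simp: V_def)

  \<comment> \<open>Arcs meet only trivially, in the same edge and parameter, or in ends that name
    the same branch vertex; the later incidence claims reduce to this.\<close>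
  have meet: "(e = f \<and> x = y) \<or>
      ((x = 0 \<or> x = 1) \<and> (y = 0 \<or> y = 1) \<and>
        (if x = 0 then fst e else snd e) = (if y = 0 then fst f else snd f))"
    if "e \<in> E" "f \<in> E" "0 \<le> x" "x \<le> 1" "0 \<le> y" "y \<le> 1" "\<gamma> e x = \<gamma> f y" for e f x y
  proof (cases "(x = 0 \<or> x = 1) \<or> (y = 0 \<or> y = 1)")
    case True
    have bdry: "\<gamma> e' z \<in> p ` V \<longleftrightarrow> z = 0 \<or> z = 1" if "e' \<in> E" "0 \<le> z" "z \<le> 1" for e' z
    proof (cases "0 < z \<and> z < 1")
      case False
      then have "z = 0 \<or> z = 1" using that by auto
      then show ?thesis using ends[OF that(1)] in_V[OF that(1)] by auto
    qed (use off_V that in auto)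
    have xy: "x = 0 \<or> x = 1" "y = 0 \<or> y = 1"
      using True bdry[of e x] bdry[of f y] that by auto
    then have "p (if x = 0 then fst e else snd e) = p (if y = 0 then fst f else snd f)"
      using that(7) ends[OF that(1)] ends[OF that(2)] by auto
    then have "(if x = 0 then fst e else snd e) = (if y = 0 then fst f else snd f)"
      by (rule inj_onD[OF inj_p]) (use in_V that(1,2) in \<open>simp_all split: if_split\<close>)
    with xy show ?thesis by blast
  next
    case False
    then have "e = f" using disjoint[of e f x y] that by auto
    moreover have "x = y"
      using arc[OF that(1)] that \<open>e = f\<close> by (auto simp: arc_def inj_on_def)
    ultimately show ?thesis by blast
  qed

  \<comment> \<open>Branch vertices may have several names \<open>pt e i\<close>. One is chosen, and
    \<open>well_def\<close> shows that the point does not depend on the choice.\<close>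
  define rep where "rep z = (SOME ei. fst ei \<in> E \<and> snd ei \<le> w (fst ei) \<and> z = pt (fst ei) (snd ei))" for z
  define \<Phi> where "\<Phi> z = \<gamma> (fst (rep z)) (tm (fst (rep z)) (snd (rep z)))" for z
  have \<gamma>_pt: "\<gamma> e (tm e i) = (if i = 0 then p (fst e) else if i = w e then p (snd e) else \<gamma> e (tm e i))"
    if "e \<in> E" for e i
    using ends[OF that] tm_w[OF that] by (auto simp: tm_def)
  have well_def: "\<gamma> e (tm e i) = \<gamma> f (tm f j)"
    if "e \<in> E" "f \<in> E" "i \<le> w e" "j \<le> w f" "pt e i = pt f j" for e f i j
  proof (cases "(0 < i \<and> i < w e) \<or> (0 < j \<and> j < w f)")
    case True
    then show ?thesis using pt_eq_inner[of i e f j] pt_eq_inner[of j f e i] that by auto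
  next
    case False
    then have "i = 0 \<or> i = w e" "j = 0 \<or> j = w f" using that by auto
    then show ?thesis
      using that by (subst (1 2) \<gamma>_pt) (auto simp: br_eq_iff)
  qed
  have \<Phi>: "\<Phi> (pt e i) = \<gamma> e (tm e i)" if "e \<in> E" "i \<le> w e" for e i
  proof -
    let ?P = "\<lambda>ei. fst ei \<in> E \<and> snd ei \<le> w (fst ei) \<and> pt e i = pt (fst ei) (snd ei)"
    have "?P (rep (pt e i))" unfolding rep_def by (rule someI[of ?P "(e, i)"]) (use that in auto)
    then show ?thesis unfolding \<Phi>_def by (intro well_def that) (simp_all del: pt_0 pt_w)
  qed

  \<comment> \<open>Along one arc, \<open>j\<close> is squeezed between \<open>i\<close> and
    \<open>Suc i\<close>; at a common end of arcs, \<open>x\<close> is 0 or 1, so the segment is the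
    first or the last of its path.\<close>
  have on_seg: "pt f j \<in> seg e i"
    if "e \<in> E" "f \<in> E" "i < w e" "j \<le> w f" "tm e i \<le> x" "x \<le> tm e (Suc i)" "\<gamma> e x = \<gamma> f (tm f j)"
    for e f i j x
  proof -
    have x01: "0 \<le> x" "x \<le> 1" using that tm_01[of e i] tm_01[of e "Suc i"] by auto
    from meet[OF that(1,2) x01 tm_01[OF that(2,4)] that(7)] show ?thesis
    proof
      assume same: "e = f \<and> x = tm f j"
      then have "i \<le> j" "j \<le> Suc i" using that tm_le by auto
      then show ?thesis using same by (auto simp: seg_def le_Suc_eq)
    next
      assume "(x = 0 \<or> x = 1) \<and> (tm f j = 0 \<or> tm f j = 1) \<and>
        (if x = 0 then fst e else snd e) = (if tm f j = 0 then fst f else snd f)"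
      then have *: "(if x = 0 then fst e else snd e) = (if tm f j = 0 then fst f else snd f)"
        "tm f j = 0 \<or> tm f j = 1" "x = 0 \<or> x = 1" by blast+
      have j: "j = (if tm f j = 0 then 0 else w f)"
        using *(2) w_pos[OF that(2)] by (auto simp: tm_def)
      have "pt f j = br (if tm f j = 0 then fst f else snd f)"
        using that(2) by (subst j) auto
      moreover have "br (if x = 0 then fst e else snd e) \<in> seg e i"
      proof (cases "x = 0")
        case True
        then have "i = 0" using tm_le[OF that(1), of i 0] that(5) by (simp add: tm_def)
        then show ?thesis using True by (simp add: seg_def)
      next
        case False
        then have "x = 1" using *(3) by simp
        then have "w e \<le> Suc i" using tm_le[OF that(1), of "w e" "Suc i"] that(1,6) by simp
        then have "Suc i = w e" using that(3) by simp
        then show ?thesis using False that(1) by (simp add: seg_def)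
      qed
      ultimately show ?thesis using *(1) by simp
    qed
  qed

  have cross: "\<exists>z \<in> verts G. \<gamma> e x = \<Phi> z"
    if "e \<in> E" "f \<in> E" "i < w e" "j < w f" "seg e i \<noteq> seg f j" "\<gamma> e x = \<gamma> f y"
      "tm e i \<le> x" "x \<le> tm e (Suc i)" "tm f j \<le> y" "y \<le> tm f (Suc j)" for e f i j x y
  proof -
    have vert: "pt e m \<in> verts G" if "m \<le> w e" for m
      using that \<open>e \<in> E\<close> by (auto simp: G_def pts_def)
    have "\<exists>m \<le> w e. x = tm e m"
    proof -
      have b: "0 \<le> x" "x \<le> 1" "0 \<le> y" "y \<le> 1"
        using that tm_01[of e i] tm_01[of e "Suc i"] tm_01[of f j] tm_01[of f "Suc j"] by auto
      from meet[OF that(1,2) b that(6)] show ?thesis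
      proof
        assume eq: "e = f \<and> x = y"
        then have "i \<noteq> j" using that by auto
        moreover have "i \<le> Suc j" "j \<le> Suc i"
          using that eq tm_le[of e i "Suc j"] tm_le[of e j "Suc i"] by auto
        ultimately have "j = Suc i \<or> i = Suc j" by linarith
        then have "x = tm e (max i j)" using that eq by auto
        then show ?thesis using that eq by (intro exI[of _ "max i j"]) auto
      next
        assume "(x = 0 \<or> x = 1) \<and> (y = 0 \<or> y = 1) \<and>
          (if x = 0 then fst e else snd e) = (if y = 0 then fst f else snd f)"
        then have "x = tm e 0 \<or> x = tm e (w e)" using tm_w[OF that(1)] by (auto simp: tm_def)
        then show ?thesis by blast
      qed
    qed
    then show ?thesis using \<Phi>[OF that(1)] vert by metis
  qed

  \<comment> \<open>\<open>plane_drawing\<close> indexes curves by edges as sets, so an edge of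
    \<open>E\<close> and a position have to be recovered from \<open>F\<close>.\<close>
  define pick where "pick F = (SOME ei. fst ei \<in> E \<and> snd ei < w (fst ei) \<and> F = case_prod seg ei)" for F
  have pick: "fst (pick F) \<in> E" "snd (pick F) < w (fst (pick F))" "F = seg (fst (pick F)) (snd (pick F))"
    if F: "F \<in> edges G" for F
  proof -
    let ?P = "\<lambda>ei. fst ei \<in> E \<and> snd ei < w (fst ei) \<and> F = case_prod seg ei"
    obtain e i where "e \<in> E" "i < w e" "F = seg e i" using F by (auto simp: G_def segs_def)
    then have "?P (e, i)" by simp
    then have "?P (pick F)" unfolding pick_def by (rule someI)
    then show "fst (pick F) \<in> E" "snd (pick F) < w (fst (pick F))"
      "F = seg (fst (pick F)) (snd (pick F))" by (auto simp: case_prod_beta)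
  qed
  define \<kappa> where "\<kappa> F = (case pick F of (e, i) \<Rightarrow> subpath (tm e i) (tm e (Suc i)) (\<gamma> e))" for F

  have "plane_drawing G \<Phi> \<kappa>"
    unfolding plane_drawing_def
  proof (intro conjI ballI impI)
    show "inj_on \<Phi> (verts G)"
    proof (rule inj_onI)
      fix a b assume "a \<in> verts G" "b \<in> verts G" and eq: "\<Phi> a = \<Phi> b"
      then obtain e i f j where ab: "e \<in> E" "i \<le> w e" "a = pt e i" "f \<in> E" "j \<le> w f" "b = pt f j"
        by (auto simp: G_def pts_def)
      have "\<gamma> e (tm e i) = \<gamma> f (tm f j)" using eq ab \<Phi> by simp
      from meet[OF ab(1,4) tm_01[OF ab(1,2)] tm_01[OF ab(4,5)] this] show "a = b"
      proof
        assume "e = f \<and> tm e i = tm f j"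
        then show ?thesis using ab w_pos[of e] by (auto simp: tm_def)
      next
        assume "(tm e i = 0 \<or> tm e i = 1) \<and> (tm f j = 0 \<or> tm f j = 1) \<and>
          (if tm e i = 0 then fst e else snd e) = (if tm f j = 0 then fst f else snd f)"
        then have *: "(if tm e i = 0 then fst e else snd e) = (if tm f j = 0 then fst f else snd f)"
          "tm e i = 0 \<or> tm e i = 1" "tm f j = 0 \<or> tm f j = 1" by blast+
        have "i = (if tm e i = 0 then 0 else w e)" "j = (if tm f j = 0 then 0 else w f)"
          using *(2,3) w_pos[OF ab(1)] w_pos[OF ab(4)] by (auto simp: tm_def)
        then have "pt e i = br (if tm e i = 0 then fst e else snd e)"
          "pt f j = br (if tm f j = 0 then fst f else snd f)"
          using ab(1,4) pt_0 pt_w by (metis (full_types))+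
        then show ?thesis using *(1) ab by simp
      qed
    qed
  next
    fix F assume F: "F \<in> edges G"
    obtain e i where ei: "pick F = (e, i)" by (cases "pick F")
    have e: "e \<in> E" "i < w e" "F = seg e i" using pick[OF F] ei by auto
    have lt: "tm e i < tm e (Suc i)" using tm_le[OF e(1), of "Suc i" i] by auto
    have \<kappa>F: "\<kappa> F = subpath (tm e i) (tm e (Suc i)) (\<gamma> e)" by (simp add: \<kappa>_def ei)
    show "arc (\<kappa> F)"
      unfolding \<kappa>F using e lt tm_01[of e i] tm_01[of e "Suc i"] by (intro arc_subpath_arc arc) auto
    show "{pathstart (\<kappa> F), pathfinish (\<kappa> F)} = \<Phi> ` F"
      unfolding \<kappa>F using e \<Phi> by (simp add: seg_def)
    fix v assume "v \<in> verts G" "\<Phi> v \<in> path_image (\<kappa> F)"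
    then obtain f j x where f: "f \<in> E" "j \<le> w f" "v = pt f j"
      and x: "tm e i \<le> x" "x \<le> tm e (Suc i)" "\<gamma> e x = \<Phi> v"
      using lt unfolding \<kappa>F by (auto simp: path_image_subpath G_def pts_def)
    then show "v \<in> F" using on_seg[of e f i j x] e \<Phi> by auto
  next
    fix F F' assume F: "F \<in> edges G" "F' \<in> edges G" "F \<noteq> F'"
    obtain e i where ei: "pick F = (e, i)" by (cases "pick F")
    obtain f j where fj: "pick F' = (f, j)" by (cases "pick F'")
    have e: "e \<in> E" "i < w e" "F = seg e i" using pick[OF F(1)] ei by auto
    have f: "f \<in> E" "j < w f" "F' = seg f j" using pick[OF F(2)] fj by auto
    have le: "tm e i \<le> tm e (Suc i)" "tm f j \<le> tm f (Suc j)" using tm_le e f by auto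
    show "path_image (\<kappa> F) \<inter> path_image (\<kappa> F') \<subseteq> \<Phi> ` (F \<inter> F')"
    proof
      fix q assume "q \<in> path_image (\<kappa> F) \<inter> path_image (\<kappa> F')"
      then obtain x y where x: "tm e i \<le> x" "x \<le> tm e (Suc i)" "q = \<gamma> e x"
        and y: "tm f j \<le> y" "y \<le> tm f (Suc j)" "q = \<gamma> f y"
        using le by (auto simp: \<kappa>_def ei fj path_image_subpath)
      obtain z where z: "z \<in> verts G" "q = \<Phi> z"
        using cross[of e f i j x y] e f x y F(3) by metis
      then obtain g m where g: "g \<in> E" "m \<le> w g" "z = pt g m" by (auto simp: G_def pts_def)
      have "z \<in> F" "z \<in> F'"
        using on_seg[of e g i m x] on_seg[of f g j m y] e f g x y z \<Phi> by auto
      then show "q \<in> \<Phi> ` (F \<inter> F')" using z by blast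
    qed
  qed
  then show ?thesis unfolding planar_def by blast
qed

end

section \<open>The annular grid with ears\<close>

definition hor :: "nat \<Rightarrow> nat \<Rightarrow> nat \<Rightarrow> (nat \<times> nat) \<times> (nat \<times> nat)" where
  "hor k c y = ((c, y), (Suc c mod (2 * k), y))"

definition ver :: "nat \<Rightarrow> nat \<Rightarrow> (nat \<times> nat) \<times> (nat \<times> nat)" where
  "ver c z = ((c, z), (c, Suc z))"

definition ring_row :: "nat \<Rightarrow> nat \<Rightarrow> ((nat \<times> nat) \<times> (nat \<times> nat)) set" where
  "ring_row k y = (\<lambda>c. hor k c y) ` {..<2 * k}"

definition spokes :: "nat \<Rightarrow> nat \<Rightarrow> ((nat \<times> nat) \<times> (nat \<times> nat)) set" where
  "spokes k n = case_prod ver ` ({..<2 * k} \<times> {..<n})"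

text \<open>Row 0 keeps every second edge only: ear \<open>i\<close> joins columns
  \<open>2 * i\<close> and \<open>2 * i + 1\<close>, and different ears have no common end.\<close>

definition ears :: "nat \<Rightarrow> ((nat \<times> nat) \<times> (nat \<times> nat)) set" where
  "ears k = (\<lambda>i. hor k (2 * i) 0) ` {..<k}"

definition annulus :: "nat \<Rightarrow> nat \<Rightarrow> ((nat \<times> nat) \<times> (nat \<times> nat)) set" where
  "annulus k n = ears k \<union> \<Union> (ring_row k ` {1..n}) \<union> spokes k n"

text \<open>The first case admits all columns in row 0, also those without an ear: the arguments on
  orientation and drawing hold for the full cyclic grid.\<close>

lemma annulus_cases:
  assumes "e \<in> annulus k n"
  obtains c y where "c < 2 * k" "y \<le> n" "e = hor k c y"
  | c z where "c < 2 * k" "z < n" "e = ver c z"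
proof -
  consider i where "i < k" "e = hor k (2 * i) 0" | c y where "c < 2 * k" "y \<le> n" "e = hor k c y"
    | c z where "c < 2 * k" "z < n" "e = ver c z"
    using assms by (auto simp: annulus_def ears_def ring_row_def spokes_def)
  then show ?thesis
  proof cases
    case (1 i)
    then show ?thesis using that(1)[of "2 * i" 0] by simp
  qed (use that in auto)
qed

text \<open>Polar coordinates: column \<open>x\<close> at angle \<open>2 * pi * x / (2 * k)\<close>, row \<open>0\<close> outermost.\<close>
definition polar :: "nat \<Rightarrow> nat \<Rightarrow> real \<Rightarrow> real \<Rightarrow> complex" where
  "polar k n x z = rcis (real (Suc n) - z) (pi * x / real k)"

text \<open>For \<open>z \<le> n\<close> the radius is positive, so the modulus gives
  \<open>z\<close>; the angle gives \<open>x\<close> up to multiples of \<open>2 * k\<close>, and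
  the last hypothesis excludes the nonzero ones.\<close>

lemma polar_eqD:
  assumes "polar k n x z = polar k n x' z'" "z \<le> n" "z' \<le> n" "\<bar>x - x'\<bar> < 2 * k"
  shows "x = x' \<and> z = z'"
proof -
  have k: "real k > 0" using assms(4) by (cases k) auto
  have "\<bar>real (Suc n) - z\<bar> = \<bar>real (Suc n) - z'\<bar>"
    using arg_cong[OF assms(1), of cmod] by (simp add: polar_def)
  then have z: "z = z'" using assms by simp
  have "complex_of_real (real (Suc n) - z') \<noteq> 0" using assms(3) by (simp del: of_real_diff)
  then have "cis (pi * x / real k) = cis (pi * x' / real k)"
    using assms(1) unfolding polar_def rcis_def z by (metis mult_left_cancel)
  then have "sin (pi * x / real k) = sin (pi * x' / real k) \<and>
      cos (pi * x / real k) = cos (pi * x' / real k)"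
    by (simp add: complex_eq_iff)
  then obtain m :: int where "pi * x / real k = pi * x' / real k + 2 * pi * real_of_int m"
    unfolding sin_cos_eq_iff by blast
  then have "pi * (x - x') = pi * (2 * real k * real_of_int m)"
    using k by (simp add: field_simps)
  then have m: "x - x' = 2 * real k * real_of_int m" by simp
  then have "2 * real k * \<bar>real_of_int m\<bar> < 2 * real k * 1"
    using assms(4) k by (simp add: abs_mult)
  then have "\<bar>real_of_int m\<bar> < 1" using k by (subst (asm) mult_less_cancel_left_pos) auto
  then have "m = 0" by linarith
  then show ?thesis using m z by simp
qed

lemma polar_wrap: "k > 0 \<Longrightarrow> polar k n (2 * real k) z = polar k n 0 z"
  by (simp add: polar_def rcis_def mult.commute[of pi])

text \<open>The horizontal edges of an inner ring are shorter, which compensates for the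
  \<open>2 * r\<close> longer climbs to the ears, so that all the relevant cycles have equal length.\<close>
definition factor :: "nat \<Rightarrow> nat \<Rightarrow> nat \<Rightarrow> (nat \<times> nat) \<times> (nat \<times> nat) \<Rightarrow> nat" where
  "factor r k n e = (if snd (fst e) \<noteq> snd (snd e) then k
    else if even (fst (fst e)) then 1 else 2 * r * (n - snd (fst e)) + 1)"

text \<open>Choosing a point of \<open>S\<close> in each \<open>P i\<close> that is hit is injective
  by disjointness. This serves for the rings and for the surroundings of the ears.\<close>

lemma card_hit_le:
  assumes "finite S" "\<And>i j. i \<in> I \<Longrightarrow> j \<in> I \<Longrightarrow> i \<noteq> j \<Longrightarrow> P i \<inter> P j = {}"
  shows "card {i \<in> I. P i \<inter> S \<noteq> {}} \<le> card S"
proof -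
  define f where "f i = (SOME x. x \<in> P i \<inter> S)" for i
  have f: "f i \<in> P i \<inter> S" if "P i \<inter> S \<noteq> {}" for i
    unfolding f_def by (rule someI_ex) (use that in blast)
  show ?thesis
  proof (rule card_inj_on_le[OF _ _ assms(1)])
    show "inj_on f {i \<in> I. P i \<inter> S \<noteq> {}}"
    proof (rule inj_onI)
      fix i j assume "i \<in> {i \<in> I. P i \<inter> S \<noteq> {}}" "j \<in> {i \<in> I. P i \<inter> S \<noteq> {}}" "f i = f j"
      then show "i = j" using f[of i] f[of j] assms(2)[of i j] by auto
    qed
  qed (use f in auto)
qed

section \<open>The weighted grid as a subdivision, and its plane drawing\<close>

locale annular_grid =
  fixes r s k n a g :: nat
  assumes k: "k = r + s" and n: "n = Suc s" and pos: "r \<ge> 1" "s \<ge> 1" "a \<ge> 2" "g \<ge> 2"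
begin

definition w :: "(nat \<times> nat) \<times> (nat \<times> nat) \<Rightarrow> nat" where
  "w e = (if e \<in> ears k then a else factor r k n e * g)"

text \<open>Parity keeps branch vertices and inner vertices apart inside the naturals.\<close>

definition br :: "nat \<times> nat \<Rightarrow> nat" where
  "br u = 2 * to_nat u"

definition inn :: "(nat \<times> nat) \<times> (nat \<times> nat) \<Rightarrow> nat \<Rightarrow> nat" where
  "inn e i = Suc (2 * to_nat (e, i))"

lemma k2: "k \<ge> 2"
  using k pos by simp

lemma Suc_mod_neq: "c < 2 * k \<Longrightarrow> Suc c mod (2 * k) \<noteq> c"
  using k2 by (auto simp: mod_Suc)

sublocale subdivision "annulus k n" w br inn
proof
  show "finite (annulus k n)" by (simp add: annulus_def ears_def ring_row_def spokes_def)
next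
  fix u v assume "(u, v) \<in> annulus k n"
  then show "u \<noteq> v"
    by (cases rule: annulus_cases) (use Suc_mod_neq in \<open>force simp: hor_def ver_def\<close>)+
next
  fix u v assume "(u, v) \<in> annulus k n"
  then show "(v, u) \<notin> annulus k n"
  proof (cases rule: annulus_cases)
    case (1 c y)
    \<comment> \<open>With at least four columns, two steps around a ring do not return to the
      start, so no edge occurs in both orientations.\<close>
    have "Suc (Suc c mod (2 * k)) mod (2 * k) \<noteq> c"
      using k2 1 by (auto simp: mod_Suc)
    then show ?thesis using 1 by (auto elim!: annulus_cases simp: hor_def ver_def)
  next
    case (2 c z)
    then show ?thesis by (auto elim!: annulus_cases simp: hor_def ver_def)
  qed
next
  fix e
  have "factor r k n e \<ge> 1" using k2 by (simp add: factor_def)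
  then have "factor r k n e * g \<ge> 1 * 2" using pos by (intro mult_le_mono) auto
  then show "w e \<ge> 2" using pos by (simp add: w_def)
next
  fix u i and e show "br u \<noteq> inn e i" unfolding br_def inn_def by presburger
qed (auto simp: br_def inn_def)

lemma planar_annulus: "planar G"
proof -
  define p :: "nat \<times> nat \<Rightarrow> complex" where "p u = polar k n (real (fst u)) (real (snd u))" for u
  \<comment> \<open>Switch between the two kinds of edges: 1 gives an arc of a circle, 0 a radial
    segment.\<close>
  define h :: "(nat \<times> nat) \<times> (nat \<times> nat) \<Rightarrow> real" where "h e = of_bool (snd (fst e) = snd (snd e))" for e
  define \<gamma> :: "(nat \<times> nat) \<times> (nat \<times> nat) \<Rightarrow> real \<Rightarrow> complex" where
    "\<gamma> e x = polar k n (real (fst (fst e)) + h e * x) (real (snd (fst e)) + (1 - h e) * x)" for e x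
  have \<gamma>_hor: "\<gamma> (hor k c y) x = polar k n (c + x) y" for c y x
    by (simp add: \<gamma>_def h_def hor_def)
  have \<gamma>_ver: "\<gamma> (ver c z) x = polar k n c (z + x)" for c z x
    by (simp add: \<gamma>_def h_def ver_def)
  have V: "c < 2 * k \<and> y \<le> n" if "(c, y) \<in> fst ` annulus k n \<union> snd ` annulus k n" for c y
    using that k2 by (auto elim!: annulus_cases simp: hor_def ver_def)
  have eqD: "x = x' \<and> z = z'" if "polar k n x z = polar k n x' z'" "z \<le> n" "z' \<le> n"
    "0 \<le> x" "0 \<le> x'" "x < 2 * k" "x' < 2 * k" for x z x' z'
    using that by (intro polar_eqD[of k n]) auto
  \<comment> \<open>Interior points of an edge have exactly one non-integral grid coordinate; this
    fact and the next turn that into disjointness from vertices and other edges.\<close>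
  have nat_frac: False if "real c + x = real c'" "0 < x" "x < 1" for c c' x
  proof -
    have "real c < real c'" "real c' < real (Suc c)" using that by auto
    then show False by simp
  qed
  have nat_frac2: "c = c'" if "real c + x = real c' + x'" "0 < x" "x < 1" "0 < x'" "x' < 1"
    for c c' x x'
  proof -
    have "real c < real (Suc c')" "real c' < real (Suc c)" using that by auto
    then show ?thesis by simp
  qed
  have bound: "real c + x < 2 * real k" if "c < 2 * k" "x < 1" for c x
  proof -
    have "real (Suc c) \<le> real (2 * k)" using that(1) by (intro of_nat_mono) simp
    then show ?thesis using that(2) by simp
  qed
  have bound': "real z + x \<le> real n" if "z < n" "x \<le> 1" for z x
  proof -
    have "real (Suc z) \<le> real n" using that(1) by (intro of_nat_mono) simp
    then show ?thesis using that(2) by simp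
  qed
  show ?thesis
  proof (rule planar_G[of p \<gamma>])
    show "inj_on p (fst ` annulus k n \<union> snd ` annulus k n)"
    proof (rule inj_onI, clarify)
      fix c y c' y'
      assume "(c, y) \<in> fst ` annulus k n \<union> snd ` annulus k n"
        "(c', y') \<in> fst ` annulus k n \<union> snd ` annulus k n" "p (c, y) = p (c', y')"
      then show "c = c' \<and> y = y'"
        using eqD[of c y c' y'] V[of c y] V[of c' y'] by (simp add: p_def)
    qed
  next
    fix e assume e: "e \<in> annulus k n"
    have "continuous_on {0..1} (\<gamma> e)"
      unfolding \<gamma>_def polar_def rcis_def cis_conv_exp
      using k2 by (intro continuous_intros) auto
    moreover have "inj_on (\<gamma> e) {0..1}"
    proof (rule inj_onI)
      fix x y :: real assume xy: "x \<in> {0..1}" "y \<in> {0..1}" "\<gamma> e x = \<gamma> e y"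
      from e show "x = y"
      proof (cases rule: annulus_cases)
        case (1 c z)
        \<comment> \<open>In the last column \<open>c + x\<close> may equal \<open>2 * k\<close>,
          outside the range of \<open>eqD\<close>; the difference bound in \<open>polar_eqD\<close>
          still applies.\<close>
        have "\<bar>(c + x) - (c + y)\<bar> < 2 * real k" using xy k2 by auto
        then show ?thesis
          using polar_eqD[of k n "c + x" z "c + y" z] 1 xy by (simp add: \<gamma>_hor)
      next
        case (2 c z)
        then show ?thesis
          using polar_eqD[of k n c "z + x" c "z + y"] xy bound'[of z x] bound'[of z y] k2
          by (simp add: \<gamma>_ver)
      qed
    qed
    ultimately show "arc (\<gamma> e)" by (simp add: arc_def path_def)
    show "\<gamma> e 0 = p (fst e)" by (simp add: \<gamma>_def p_def)
    show "\<gamma> e 1 = p (snd e)"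
      using e
    proof (cases rule: annulus_cases)
      case (1 c y)
      show ?thesis
      proof (cases "Suc c = 2 * k")
        case True
        then have "real c + 1 = 2 * real k" by linarith
        then have "\<gamma> e 1 = polar k n 0 y" using 1 k2 by (simp add: \<gamma>_hor polar_wrap)
        then show ?thesis using True 1 by (simp add: p_def hor_def)
      next
        case False
        then have "Suc c mod (2 * k) = Suc c" using 1 by simp
        moreover have "\<gamma> e 1 = polar k n (real (Suc c)) y" using 1 by (simp add: \<gamma>_hor add.commute)
        ultimately show ?thesis using 1 by (simp add: p_def hor_def)
      qed
    next
      case (2 c z)
      then have "\<gamma> e 1 = polar k n c (real (Suc z))" by (simp add: \<gamma>_ver add.commute)
      then show ?thesis using 2 by (simp add: p_def ver_def)
    qed
    fix x :: real assume x: "0 < x" "x < 1"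
    show "\<gamma> e x \<notin> p ` (fst ` annulus k n \<union> snd ` annulus k n)"
    proof
      assume "\<gamma> e x \<in> p ` (fst ` annulus k n \<union> snd ` annulus k n)"
      then obtain c' y' where v: "(c', y') \<in> fst ` annulus k n \<union> snd ` annulus k n"
        "\<gamma> e x = p (c', y')" by (metis (no_types, lifting) imageE surj_pair)
      note v' = V[OF v(1)]
      from e show False
      proof (cases rule: annulus_cases)
        case (1 c y)
        then show False
          using eqD[of "c + x" y c' y'] v v' x bound[of c x] nat_frac[of c x c']
          by (simp add: \<gamma>_hor p_def)
      next
        case (2 c z)
        then show False
          using eqD[of c "z + x" c' y'] v v' x bound'[of z x] nat_frac[of z x y']
          by (simp add: \<gamma>_ver p_def)
      qed
    qed
    fix f y assume f: "f \<in> annulus k n" and y: "0 < y" "y < 1" and eq: "\<gamma> e x = \<gamma> f y"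
    from e show "e = f"
    proof (cases rule: annulus_cases)
      case e1: (1 c z)
      from f show ?thesis
      proof (cases rule: annulus_cases)
        case (1 c' z')
        then show ?thesis
          using eqD[of "c + x" z "c' + y" z'] e1 eq x y bound[of c x] bound[of c' y]
            nat_frac2[of c x c' y] by (simp add: \<gamma>_hor)
      next
        case (2 c' z')
        then show ?thesis
          using eqD[of "c + x" z c' "z' + y"] e1 eq x y bound[of c x] bound'[of z' y]
            nat_frac[of z' y z] by (simp add: \<gamma>_hor \<gamma>_ver)
      qed
    next
      case e2: (2 c z)
      from f show ?thesis
      proof (cases rule: annulus_cases)
        case (1 c' z')
        then show ?thesis
          using eqD[of c "z + x" "c' + y" z'] e2 eq x y bound'[of z x] bound[of c' y]
            nat_frac[of z x z'] by (simp add: \<gamma>_hor \<gamma>_ver)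
      next
        case (2 c' z')
        then show ?thesis
          using eqD[of c "z + x" c' "z' + y"] e2 eq x y bound'[of z x] bound'[of z' y]
            nat_frac2[of z x z' y] by (simp add: \<gamma>_ver)
      qed
    qed
  qed
qed

text \<open>The edges of the cycle along row \<open>y\<close> that climbs to the ears \<open>i \<in> U\<close>.\<close>
definition block_edges :: "nat \<Rightarrow> nat set \<Rightarrow> nat \<Rightarrow> ((nat \<times> nat) \<times> (nat \<times> nat)) set" where
  "block_edges y U i = insert (hor k (2 * i + 1) y)
    (if i \<in> U then insert (hor k (2 * i) 0) (ver (2 * i) ` {..<y} \<union> ver (2 * i + 1) ` {..<y})
     else {hor k (2 * i) y})"

text \<open>Rows are numbered from the outside, so the climb to row 0 is the reversed list. The edge
  to the next pair of columns comes from appending the head of the next block.\<close>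

definition block :: "nat \<Rightarrow> nat set \<Rightarrow> nat \<Rightarrow> (nat \<times> nat) list" where
  "block y U i = (if i \<in> U
    then rev (map (Pair (2 * i)) [0..<Suc y]) @ map (Pair (2 * i + 1)) [0..<Suc y]
    else [(2 * i, y), (2 * i + 1, y)])"

lemma block_edges_subset:
  assumes "i < k" "y \<in> {1..n}"
  shows "block_edges y U i \<subseteq> annulus k n"
proof -
  have "hor k (2 * i + 1) y \<in> ring_row k y" "hor k (2 * i) y \<in> ring_row k y"
    "hor k (2 * i) 0 \<in> ears k"
    using assms by (auto simp: ring_row_def ears_def)
  moreover have "ver c z \<in> spokes k n" if "c = 2 * i \<or> c = 2 * i + 1" "z < y" for c z
    using that assms unfolding spokes_def by (intro image_eqI[of _ _ "(c, z)"]) auto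
  ultimately show ?thesis
    using assms(2) by (auto simp: block_edges_def annulus_def)
qed

lemma block_edges_col:
  assumes "e \<in> block_edges y U i"
  shows "fst (fst e) div 2 = i"
  using assms by (auto simp: block_edges_def hor_def ver_def split: if_splits)

lemma hd_block: "hd (block y U i) = (2 * i, y)"
  by (simp add: block_def)

lemma path_edges_block:
  assumes "i < k"
  shows "path_edges (block y U i @ [(2 * (Suc i mod k), y)]) = (\<lambda>(u, v). {u, v}) ` block_edges y U i"
proof -
  have link: "(\<lambda>(u, v). {u, v}) (hor k (Suc (2 * i)) y) = {(Suc (2 * i), y), (2 * (Suc i mod k), y)}"
    using assms by (auto simp: hor_def mod_Suc)
  have rung: "(\<lambda>(u, v). {u, v}) (hor k (2 * i) z) = {(2 * i, z), (2 * i + 1, z)}" for z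
    using assms by (auto simp: hor_def)
  show ?thesis
  proof (cases "i \<in> U")
    case True
    have split3: "map (Pair (2 * i + 1)) [0..<Suc y] = map (Pair (2 * i + 1)) [0..<y] @ [(2 * i + 1, y)]"
      by simp
    have split: "rev (map (Pair (2 * i)) [0..<Suc y]) = rev (map (Pair (2 * i)) [1..<Suc y]) @ [(2 * i, 0)]"
      "map (Pair (2 * i + 1)) [0..<Suc y] = (2 * i + 1, 0) # map (Pair (2 * i + 1)) [1..<Suc y]"
      by (simp_all add: upt_conv_Cons del: upt_Suc)
    let ?U = "rev (map (Pair (2 * i)) [0..<Suc y])" and ?D = "map (Pair (2 * i + 1)) [0..<Suc y]"
      and ?h = "(2 * (Suc i mod k), y)"
    have "path_edges (?U @ ?D @ [?h]) = path_edges ?U \<union> path_edges ((2 * i, 0) # ?D @ [?h])"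
      using path_edges_append[of "rev (map (Pair (2 * i)) [1..<Suc y])" "(2 * i, 0)" "?D @ [?h]"]
        split(1) by (metis append.assoc append_Cons append_Nil)
    also have "path_edges ((2 * i, 0) # ?D @ [?h]) = insert {(2 * i, 0), (2 * i + 1, 0)} (path_edges (?D @ [?h]))"
      by (simp only: split(2) append_Cons path_edges.simps)
    also have "path_edges (?D @ [?h]) = path_edges ?D \<union> {{(2 * i + 1, y), ?h}}"
      using path_edges_append[of "map (Pair (2 * i + 1)) [0..<y]" "(2 * i + 1, y)" "[?h]"] split3
      by (metis append.assoc append_Cons append_Nil path_edges.simps(1,3))
    also have "path_edges ?U = (\<lambda>(u, v). {u, v}) ` ver (2 * i) ` {..<y}"
      unfolding path_edges_rev path_edges_map_upt by (simp add: ver_def image_image atLeast0LessThan)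
    also have "path_edges ?D = (\<lambda>(u, v). {u, v}) ` ver (2 * i + 1) ` {..<y}"
      unfolding path_edges_map_upt by (simp add: ver_def image_image atLeast0LessThan)
    finally show ?thesis
      using True by (simp add: block_def block_edges_def link rung image_Un insert_commute Un_commute
        Un_left_commute del: upt_Suc)
  next
    case False
    then show ?thesis by (simp add: block_def block_edges_def link rung insert_commute)
  qed
qed

definition ring_edges :: "nat \<Rightarrow> nat set \<Rightarrow> ((nat \<times> nat) \<times> (nat \<times> nat)) set" where
  "ring_edges y U = (\<Union>i<k. block_edges y U i)"

lemma ring_is_cycle:
  assumes "y \<in> {1..n}"
  shows "is_cycle \<lparr>verts = \<Union> (pts ` ring_edges y U), edges = \<Union> (segs ` ring_edges y U)\<rparr>"
proof (rule lift_cycle)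
  let ?vs = "concat (map (block y U) [0..<k])"
  show "distinct ?vs"
  proof (rule distinct_concat_blocks)
    fix i show "distinct (block y U i)"
      by (auto simp: block_def distinct_map inj_on_def simp del: upt_Suc)
  next
    fix i j :: nat assume "i < j"
    moreover have "fst u div 2 = i" if "u \<in> set (block y U i)" for u i
      using that by (auto simp: block_def split: if_splits simp del: upt_Suc)
    ultimately show "set (block y U i) \<inter> set (block y U j) = {}"
      by (metis disjoint_iff less_irrefl)
  qed
  have "k * 2 \<le> length ?vs"
    by (rule length_concat_blocks) (use assms in \<open>auto simp: block_def\<close>)
  then show "3 \<le> length ?vs" using k2 by linarith
  show "ring_edges y U \<subseteq> annulus k n"
    using block_edges_subset assms by (auto simp: ring_edges_def)
  have "cycle_edges ?vs = (\<Union>i<k. path_edges (block y U i @ [hd (block y U (Suc i mod k))]))"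
    using k2 by (intro cycle_edges_concat) (auto simp: block_def)
  also have "\<dots> = (\<Union>i<k. (\<lambda>(u, v). {u, v}) ` block_edges y U i)"
    using path_edges_block by (intro SUP_cong) (auto simp: hd_block)
  finally show "(\<lambda>(u, v). {u, v}) ` ring_edges y U = cycle_edges ?vs"
    by (simp add: ring_edges_def image_UN)
qed

section \<open>Weights of edges and lengths of cycles\<close>

lemma w_hor: "y \<ge> 1 \<Longrightarrow> w (hor k c y) = (if even c then g else (2 * r * (n - y) + 1) * g)"
  by (auto simp: w_def ears_def hor_def factor_def)

lemma w_ver: "w (ver c z) = k * g"
  by (auto simp: w_def ears_def hor_def ver_def factor_def)

lemma w_ear: "i < k \<Longrightarrow> w (hor k (2 * i) 0) = a"
  by (auto simp: w_def ears_def)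

lemma sum_w_block:
  assumes "i < k" "y \<in> {1..n}"
  shows "sum w (block_edges y U i) = (2 * r * (n - y) + 1) * g + (if i \<in> U then a + 2 * y * k * g else g)"
proof -
  have inj: "inj_on (ver c) {..<y}" for c by (auto simp: inj_on_def ver_def)
  have "sum w (ver c ` {..<y}) = y * k * g" for c
    by (simp add: sum.reindex[OF inj] w_ver)
  moreover have "ver (2 * i) ` {..<y} \<inter> ver (2 * i + 1) ` {..<y} = {}"
    by (auto simp: ver_def)
  ultimately have "sum w (ver (2 * i) ` {..<y} \<union> ver (2 * i + 1) ` {..<y}) = 2 * y * k * g"
    by (subst sum.union_disjoint) auto
  moreover have "hor k c z \<notin> ver c' ` X" for c z c' X by (auto simp: hor_def ver_def)
  moreover have "hor k (2 * i + 1) y \<noteq> hor k (2 * i) z" for z by (simp add: hor_def)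
  ultimately show ?thesis
    using assms w_hor[of y] w_ear[of i] by (auto simp: block_edges_def)
qed

text \<open>In units of \<open>g\<close>, the \<open>r\<close> double climbs cost
  \<open>2 * r * k * y\<close>, and the extra weight of the \<open>k\<close> odd ring edges is
  \<open>2 * r * k * (n - y)\<close>, so \<open>y\<close> cancels.\<close>

lemma sum_w_ring:
  assumes "y \<in> {1..n}" "U \<subseteq> {..<k}" "card U = r"
  shows "sum w (ring_edges y U) = r * a + (2 * r * k * n + k + s) * g"
proof -
  have "sum w (ring_edges y U) = (\<Sum>i<k. sum w (block_edges y U i))"
    unfolding ring_edges_def
  proof (rule sum.UNION_disjoint)
    show "\<forall>i\<in>{..<k}. finite (block_edges y U i)" by (simp add: block_edges_def)
    show "\<forall>i\<in>{..<k}. \<forall>j\<in>{..<k}. i \<noteq> j \<longrightarrow> block_edges y U i \<inter> block_edges y U j = {}"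
      using block_edges_col by blast
  qed simp
  also have "\<dots> = (\<Sum>i<k. (2 * r * (n - y) + 1) * g + (if i \<in> U then a + 2 * y * k * g else g))"
    using sum_w_block assms(1) by (intro sum.cong) auto
  also have "\<dots> = k * ((2 * r * (n - y) + 1) * g) + (\<Sum>i<k. if i \<in> U then a + 2 * y * k * g else g)"
    by (simp add: sum.distrib)
  also have "(\<Sum>i<k. if i \<in> U then a + 2 * y * k * g else g) = r * (a + 2 * y * k * g) + s * g"
  proof -
    have "{..<k} \<inter> {i. i \<in> U} = U" "card ({..<k} \<inter> - {i. i \<in> U}) = s"
      using assms k by (auto simp: Diff_eq[symmetric] card_Diff_subset finite_subset)
    then show ?thesis using assms by (simp add: sum.If_cases)
  qed
  also have "k * ((2 * r * (n - y) + 1) * g) + (r * (a + 2 * y * k * g) + s * g) =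
      r * a + (2 * r * k * ((n - y) + y) + k + s) * g"
    by (simp only: distrib_left distrib_right mult_1_left mult_1_right) (simp add: mult_ac)
  also have "(n - y) + y = n" using assms by simp
  finally show ?thesis .
qed

text \<open>\<open>J\<close> is the set of ears used and \<open>m\<close> the grid weight. The bound
  on \<open>m\<close> does not involve \<open>a\<close> and \<open>g\<close>, so these can be chosen
  to suit it. The pair is nonzero since a cycle has edges.\<close>

lemma cycle_length:
  assumes "is_cycle C" "subgraph C G"
  shows "\<exists>J m. J \<subseteq> {..<k} \<and> m \<le> sum (factor r k n) (annulus k n) \<and> (card J, m) \<noteq> (0, 0) \<and>
    card (edges C) = card J * a + m * g \<and> (\<forall>j\<in>J. br (2 * j, 0) \<in> verts C)"
proof -
  obtain A where A: "A \<subseteq> annulus k n" "A \<noteq> {}" "edges C = \<Union> (segs ` A)" "verts C = \<Union> (pts ` A)"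
    using cycle_decomposition[OF assms] by blast
  have fin: "finite A" using A finite_E finite_subset by blast
  define J where "J = {i \<in> {..<k}. hor k (2 * i) 0 \<in> A}"
  define m where "m = sum (factor r k n) (A - ears k)"
  have "A \<inter> ears k = (\<lambda>i. hor k (2 * i) 0) ` J" by (auto simp: J_def ears_def)
  moreover have "inj_on (\<lambda>i. hor k (2 * i) 0) J" by (auto simp: inj_on_def hor_def)
  ultimately have card_J: "card (A \<inter> ears k) = card J" by (simp add: card_image)
  have "card (edges C) = sum w (A \<inter> ears k) + sum w (A - ears k)"
    using card_Union_segs[OF A(1)] A(3) sum.Int_Diff[OF fin, of w "ears k"] by simp
  also have "sum w (A \<inter> ears k) = card J * a" by (simp add: w_def card_J)
  also have "sum w (A - ears k) = m * g" by (simp add: m_def w_def sum_distrib_right)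
  finally have len: "card (edges C) = card J * a + m * g" .
  have "m \<le> sum (factor r k n) (annulus k n)"
    unfolding m_def by (rule sum_mono2) (use A finite_E in auto)
  moreover have "(card J, m) \<noteq> (0, 0)"
  proof
    assume "(card J, m) = (0, 0)"
    then have "card (edges C) = 0" using len by simp
    then have "sum w A = 0" using card_Union_segs[OF A(1)] A(3) by simp
    moreover obtain e where e: "e \<in> A" using A by auto
    then have "w e \<ge> 2" using A w_ge_2 by blast
    ultimately show False using fin e by simp
  qed
  moreover have "br (2 * j, 0) \<in> verts C" if "j \<in> J" for j
  proof -
    have "pt (hor k (2 * j) 0) 0 \<in> pts (hor k (2 * j) 0)" unfolding pts_def by (rule imageI) simp
    then show ?thesis using that A(4) by (auto simp: J_def hor_def)
  qed
  ultimately show ?thesis using len by (intro exI[of _ J] exI[of _ m]) (auto simp: J_def)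
qed

section \<open>Cycles surviving the deletion of \<open>s\<close> vertices\<close>

definition tower :: "nat \<Rightarrow> ((nat \<times> nat) \<times> (nat \<times> nat)) set" where
  "tower i = insert (hor k (2 * i) 0) (ver (2 * i) ` {..<n} \<union> ver (2 * i + 1) ` {..<n})"

lemma tower_subset: "i < k \<Longrightarrow> tower i \<subseteq> annulus k n"
proof -
  assume i: "i < k"
  have "ver c z \<in> spokes k n" if "c = 2 * i \<or> c = 2 * i + 1" "z < n" for c z
    using that i unfolding spokes_def by (intro image_eqI[of _ _ "(c, z)"]) auto
  then show ?thesis using i by (auto simp: tower_def annulus_def ears_def)
qed

lemma ring_row_subset: "y \<in> {1..n} \<Longrightarrow> ring_row k y \<subseteq> annulus k n"
  by (auto simp: annulus_def)

lemma rows_disjoint: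
  assumes "y \<in> {1..n}" "y' \<in> {1..n}" "y \<noteq> y'"
  shows "\<Union> (pts ` ring_row k y) \<inter> \<Union> (pts ` ring_row k y') = {}"
proof (rule equals0I, clarify)
  fix x e f assume *: "e \<in> ring_row k y" "x \<in> pts e" "f \<in> ring_row k y'" "x \<in> pts f"
  have "e \<noteq> f" using *(1,3) assms(3) by (auto simp: ring_row_def hor_def)
  then have "\<exists>u. u \<in> {fst e, snd e} \<and> u \<in> {fst f, snd f}"
    using pts_meet[of e f x] * ring_row_subset assms by blast
  then show False using *(1,3) assms(3) by (auto simp: ring_row_def hor_def)
qed

lemma tower_col:
  assumes "i < k" "e \<in> tower i" "u \<in> {fst e, snd e}"
  shows "fst u div 2 = i"
  using assms by (auto simp: tower_def hor_def ver_def)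

lemma towers_disjoint:
  assumes "i < k" "i' < k" "i \<noteq> i'"
  shows "\<Union> (pts ` tower i) \<inter> \<Union> (pts ` tower i') = {}"
proof (rule equals0I, clarify)
  fix x e f assume *: "e \<in> tower i" "x \<in> pts e" "f \<in> tower i'" "x \<in> pts f"
  have "e \<noteq> f" using tower_col[of i e "fst e"] tower_col[of i' f "fst f"] * assms by auto
  then have "\<exists>u. u \<in> {fst e, snd e} \<and> u \<in> {fst f, snd f}"
    using pts_meet[of e f x] * tower_subset assms by blast
  then show False using tower_col * assms by metis
qed

text \<open>\<open>tower i\<close> contains the climbs to ear \<open>i\<close> from every ring, so
  the ring and the ears can be selected independently.\<close>

lemma ring_edges_subset:
  assumes "y \<in> {1..n}"
  shows "ring_edges y U \<subseteq> ring_row k y \<union> \<Union> (tower ` U)"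
proof -
  have "hor k (2 * i + 1) y \<in> ring_row k y" "hor k (2 * i) y \<in> ring_row k y" if "i < k" for i
    using that by (auto simp: ring_row_def)
  moreover have "insert (hor k (2 * i) 0) (ver (2 * i) ` {..<y} \<union> ver (2 * i + 1) ` {..<y}) \<subseteq> tower i" for i
    using assms by (auto simp: tower_def)
  ultimately show ?thesis by (auto simp: ring_edges_def block_edges_def split: if_splits) blast+
qed

text \<open>Pigeonhole twice: \<open>S\<close> misses one of the \<open>s + 1\<close> disjoint rings
  and at least \<open>r\<close> of the \<open>k = r + s\<close> disjoint towers.\<close>

lemma cycle_avoiding:
  assumes "finite S" "card S \<le> s"
  shows "\<exists>C. is_cycle C \<and> subgraph C (delete_verts G S) \<and>
    card (edges C) = r * a + (2 * r * k * n + k + s) * g"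
proof -
  have "card {y \<in> {1..n}. \<Union> (pts ` ring_row k y) \<inter> S \<noteq> {}} \<le> card S"
    using assms(1) rows_disjoint by (intro card_hit_le) auto
  then have "card {y \<in> {1..n}. \<Union> (pts ` ring_row k y) \<inter> S \<noteq> {}} < card {1..n}"
    using assms(2) n by simp
  then have "{y \<in> {1..n}. \<Union> (pts ` ring_row k y) \<inter> S \<noteq> {}} \<noteq> {1..n}" by (metis less_irrefl)
  then obtain y where y: "y \<in> {1..n}" "\<Union> (pts ` ring_row k y) \<inter> S = {}" by blast
  define H where "H = {i \<in> {..<k}. \<Union> (pts ` tower i) \<inter> S \<noteq> {}}"
  have "card H \<le> card S"
    unfolding H_def using assms(1) towers_disjoint by (intro card_hit_le) auto
  then have "r \<le> card ({..<k} - H)"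
    using assms(2) k by (subst card_Diff_subset) (auto simp: H_def)
  then obtain U where U: "U \<subseteq> {..<k} - H" "card U = r"
    by (metis obtain_subset_with_card_n)
  then have Uk: "U \<subseteq> {..<k}" by auto
  define C where "C = \<lparr>verts = \<Union> (pts ` ring_edges y U), edges = \<Union> (segs ` ring_edges y U)\<rparr>"
  have sub: "ring_edges y U \<subseteq> annulus k n"
    using block_edges_subset y by (auto simp: ring_edges_def)
  have avoid: "pts e \<inter> S = {}" if "e \<in> ring_edges y U" for e
    using that ring_edges_subset[OF y(1), of U] U y(2) by (fastforce simp: H_def)
  have "F \<inter> S = {}" if "F \<in> edges C" for F
    using that avoid Union_segs sub by (fastforce simp: C_def)
  then have "subgraph C (delete_verts G S)"
    using sub avoid unfolding subgraph_def delete_verts_def G_def C_def ugraph.simps by blast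
  moreover have "is_cycle C" unfolding C_def by (rule ring_is_cycle[OF y(1)])
  moreover have "card (edges C) = r * a + (2 * r * k * n + k + s) * g"
    using card_Union_segs[OF sub] sum_w_ring[OF y(1) Uk U(2)] by (simp add: C_def)
  ultimately show ?thesis by blast
qed

end

section \<open>Choice of the parameters and the common ear\<close>

theorem theorem2p2:
  fixes L :: "nat set" and t s :: nat
  assumes "L \<subseteq> {1..}" and "infinite L" and "lower_density L = 0"
    and "t \<ge> 1" and "s \<ge> 1"
  shows "\<exists>G :: nat ugraph. finite_graph G \<and> planar G \<and>
    (\<forall>C :: nat \<Rightarrow> nat ugraph. (\<forall>i \<in> {1..t}. L_cycle L G (C i)) \<longrightarrow>
       (\<exists>v \<in> verts G. \<forall>i \<in> {1..t}. v \<in> verts (C i))) \<and>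
    (\<forall>S \<subseteq> verts G. card S \<le> s \<longrightarrow> (\<exists>C. L_cycle L (delete_verts G S) C))"
proof -
  \<comment> \<open>This makes \<open>t * s < k\<close> and makes \<open>r\<close> congruent to 1
    modulo \<open>2 * s\<close>, which gives coprimality with \<open>m0\<close>.\<close>
  define r where "r = 2 * s * t + 1"
  define k where "k = r + s"
  define n where "n = Suc s"
  define m0 where "m0 = 2 * r * k * n + k + s"
  have "coprime r m0"
  proof (rule coprimeI)
    fix d assume d: "d dvd r" "d dvd m0"
    \<comment> \<open>\<open>m0\<close> is \<open>2 * s\<close> modulo \<open>r\<close>, so a common
      divisor also divides \<open>2 * s * t = r - 1\<close>, hence 1.\<close>
    have "m0 = r * (2 * k * n + 1) + 2 * s" by (simp add: m0_def k_def algebra_simps)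
    then have "d dvd 2 * s" using d by (metis dvd_add_right_iff dvd_mult2)
    then have "d dvd 2 * s * t" by (rule dvd_mult2)
    then show "is_unit d" using d(1) unfolding r_def by (metis dvd_add_right_iff)
  qed
  then obtain a g where ag: "a \<ge> 2" "g \<ge> 2" "r * a + m0 * g \<in> L"
    and avoid: "\<And>j m. j < r \<Longrightarrow> m \<le> sum (factor r k n) (annulus k n) \<Longrightarrow> (j, m) \<noteq> (0, 0) \<Longrightarrow>
      j * a + m * g \<notin> L"
    using avoiding_lengths_exist[OF assms(2,3), of r m0 "sum (factor r k n) (annulus k n)"]
    by (auto simp: r_def m0_def k_def)
  interpret annular_grid r s k n a g
    using ag assms(5) by unfold_locales (auto simp: r_def k_def n_def)
  show ?thesis
  proof (rule exI[of _ G], intro conjI allI impI)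
    show "finite_graph G" by (rule finite_graph_G)
    show "planar G" by (rule planar_annulus)
  next
    fix C :: "nat \<Rightarrow> nat ugraph" assume C: "\<forall>i\<in>{1..t}. L_cycle L G (C i)"
    have "\<exists>J. J \<subseteq> {..<k} \<and> r \<le> card J \<and> (\<forall>j\<in>J. br (2 * j, 0) \<in> verts (C i))" if "i \<in> {1..t}" for i
    proof -
      have Ci: "is_cycle (C i)" "subgraph (C i) G" "card (edges (C i)) \<in> L"
        using C that by (auto simp: L_cycle_def)
      then show ?thesis using cycle_length[OF Ci(1,2)] avoid by (metis not_le)
    qed
    then obtain J where J: "\<And>i. i \<in> {1..t} \<Longrightarrow>
        J i \<subseteq> {..<k} \<and> r \<le> card (J i) \<and> (\<forall>j\<in>J i. br (2 * j, 0) \<in> verts (C i))"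
      by metis
    \<comment> \<open>Each cycle misses at most \<open>k - r = s\<close> ears, so \<open>t\<close>
      cycles miss at most \<open>t * s < k\<close> in total; some ear lies on all of them.\<close>
    have "card (\<Union>i\<in>{1..t}. {..<k} - J i) \<le> (\<Sum>i\<in>{1..t}. card ({..<k} - J i))"
      by (rule card_UN_le) simp
    also have "\<dots> \<le> (\<Sum>i\<in>{1..t}. s)"
    proof (rule sum_mono)
      fix i assume "i \<in> {1..t}"
      then show "card ({..<k} - J i) \<le> s"
        using J[of i] by (subst card_Diff_subset) (auto simp: k_def intro: finite_subset)
    qed
    also have "\<dots> < card {..<k}" using assms(5) by (simp add: k_def r_def)
    finally have "(\<Union>i\<in>{1..t}. {..<k} - J i) \<noteq> {..<k}" by (metis less_irrefl)
    then obtain j where j: "j < k" "\<And>i. i \<in> {1..t} \<Longrightarrow> j \<in> J i" by blast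
    have "br (2 * j, 0) \<in> verts (C i)" if "i \<in> {1..t}" for i using J[OF that] j(2)[OF that] by blast
    moreover have "1 \<in> {1..t}" using assms(4) by simp
    moreover have "verts (C 1) \<subseteq> verts G"
      using C \<open>1 \<in> {1..t}\<close> by (auto simp: L_cycle_def subgraph_def)
    ultimately show "\<exists>v\<in>verts G. \<forall>i\<in>{1..t}. v \<in> verts (C i)" by blast
  next
    fix S assume S: "S \<subseteq> verts G" "card S \<le> s"
    then have "finite S" using finite_graph_G finite_subset by (auto simp: finite_graph_def)
    then show "\<exists>C. L_cycle L (delete_verts G S) C"
      using cycle_avoiding[OF _ S(2)] ag(3) unfolding L_cycle_def m0_def by metis
  qed
qed

end
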